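(* The set $\mathrm{BCL}=\{e\in\mathbb N : \mathcal L_e \text{ is TxtBC-learnable}\}$, where $\mathcal L_e$ is the uniformly computably enumerable family coded by $e$, is $\Sigma^0_5$-hard: for every $\Sigma^0_5$ predicate $P$ on $\mathbb N$ there is a computable function $h:\mathbb N\to\mathbb N$ such that for all $e$, $P(e)$ holds if and only if $h(e)\in\mathrm{BCL}$.
   Context: Fix a computable pairing function $\langle\cdot,\cdot\rangle:\mathbb N^2\to\mathbb N$ and a standard numbering $W_0,W_1,\dots$ of the computably enumerable (c.e.) sets. A number $e$ codes the uniformly computably enumerable (u.c.e.) family $\mathcal L_e=\{L_0,L_1,\dots\}$ whose $i$-th member (column) is $L_i=\{x:\langle i,x\rangle\in W_e\}$; the u.c.e. families are exactly those of this form. An enumeration is a function $f:\mathbb N\to\mathbb N$; $\mathrm{content}(f)=\{x:(\exists n)\,f(n)=x\}$; $f$ is an enumeration of (for) a set $A$ if $\mathrm{content}(f)=A$. $f\upharpoonright i$ is the initial segment of $f$ of length $i$, a finite string of natural numbers. A learning machine is a (possibly partial) computable function $M$ from finite strings of natural numbers to $\mathbb N$; a statement about a value of $M$ includes that this value is defined. $M$ TxtBC-identifies an enumeration $f$ if there is $n$ such that $W_{M(f\upharpoonright i)}=\mathrm{content}(f)$ for all $i>n$. $M$ TxtBC-learns a c.e. set $A$ if it TxtBC-identifies every enumeration of $A$. $M$ TxtBC-learns a family of c.e. sets if it TxtBC-learns every member of the family. A family is TxtBC-learnable if some learning machine TxtBC-learns it. *)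

theory Defs
  imports Main "HOL-Library.Nat_Bijection"
begin

text \<open>
  Partial recursive functions, presented as unary functions over the pairing
  function \<^const>\<open>prod_encode\<close>, which plays the role of \<open>\<langle>\<cdot>,\<cdot>\<rangle>\<close> throughout; functions of several
  arguments are applied to (nested) pairs. \<open>PrecC\<close> is primitive recursion and \<open>MuC\<close> is unbounded
  minimization; the identity is \<open>PairC FstC SndC\<close>.
\<close>

datatype code =
    ZeroC | SuccC | FstC | SndC
  | PairC code code | CompC code code | PrecC code code | MuC code

primrec eval :: "code \<Rightarrow> nat \<Rightarrow> nat option" where
  "eval ZeroC x = Some 0"
| "eval SuccC x = Some (Suc x)"
| "eval FstC x = Some (fst (prod_decode x))"
| "eval SndC x = Some (snd (prod_decode x))"
| "eval (PairC c d) x =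
    (case (eval c x, eval d x) of
       (Some u, Some v) \<Rightarrow> Some (prod_encode (u, v))
     | _ \<Rightarrow> None)"
| "eval (CompC c d) x = Option.bind (eval d x) (eval c)"
| "eval (PrecC c d) x =
    (case prod_decode x of (a, n) \<Rightarrow>
       rec_nat (eval c a)
         (\<lambda>k r. Option.bind r (\<lambda>v. eval d (prod_encode (a, prod_encode (k, v))))) n)"
| "eval (MuC c) x =
    (if \<exists>n. eval c (prod_encode (x, n)) = Some 0 \<and>
            (\<forall>m<n. \<exists>v>0. eval c (prod_encode (x, m)) = Some v)
     then Some (LEAST n. eval c (prod_encode (x, n)) = Some 0)
     else None)"

text \<open>Goedel numbering of programs: every number is the code of exactly one program.\<close>

primrec encode :: "code \<Rightarrow> nat" where
  "encode ZeroC = 0"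
| "encode SuccC = 1"
| "encode FstC = 2"
| "encode SndC = 3"
| "encode (PairC c d) = 4 * prod_encode (encode c, encode d) + 4"
| "encode (CompC c d) = 4 * prod_encode (encode c, encode d) + 5"
| "encode (PrecC c d) = 4 * prod_encode (encode c, encode d) + 6"
| "encode (MuC c) = 4 * encode c + 7"

lemma fst_prod_decode_le: "fst (prod_decode n) \<le> n"
  by (metis le_prod_encode_1 prod.collapse prod_decode_inverse)

lemma snd_prod_decode_le: "snd (prod_decode n) \<le> n"
  by (metis le_prod_encode_2 prod.collapse prod_decode_inverse)

function decode :: "nat \<Rightarrow> code" where
  "decode n =
    (if n = 0 then ZeroC
     else if n = 1 then SuccC
     else if n = 2 then FstC
     else if n = 3 then SndC
     else
       let k = n div 4 - 1; i = fst (prod_decode k); j = snd (prod_decode k) in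
       if n mod 4 = 0 then PairC (decode i) (decode j)
       else if n mod 4 = 1 then CompC (decode i) (decode j)
       else if n mod 4 = 2 then PrecC (decode i) (decode j)
       else MuC (decode k))"
  by pat_completeness auto
termination
proof -
  have *: "n div 4 - 1 < n" if "n \<noteq> 0" for n :: nat using that by presburger
  show ?thesis
    by (relation "measure id")
      (simp_all add: le_less_trans[OF fst_prod_decode_le *] le_less_trans[OF snd_prod_decode_le *]
        * del: One_nat_def)
qed

declare decode.simps [simp del]

lemma decode_encode: "decode (encode c) = c"
proof (induction c)
  case (PairC c d)
  then show ?case by (subst decode.simps) (simp add: Let_def)
next
  case (CompC c d)
  have "(4 * p + 5) div 4 = p + 1" "(4 * p + 5) mod 4 = 1" for p :: nat by presburger+
  with CompC show ?case by (subst decode.simps) (simp add: Let_def)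
next
  case (PrecC c d)
  have "(4 * p + 6) div 4 = p + 1" "(4 * p + 6) mod 4 = 2" for p :: nat by presburger+
  with PrecC show ?case by (subst decode.simps) (simp add: Let_def)
next
  case (MuC c)
  have "(4 * p + 7) div 4 = p + 1" "(4 * p + 7) mod 4 = 3" for p :: nat by presburger+
  with MuC show ?case by (subst decode.simps) (simp add: Let_def)
qed (subst decode.simps, simp)+

lemma encode_decode: "encode (decode n) = n"
proof (induction n rule: decode.induct)
  case (1 n)
  show ?case
  proof (cases "n < 4")
    case True
    then have "n = 0 \<or> n = 1 \<or> n = 2 \<or> n = 3" by auto
    then show ?thesis by (subst decode.simps) auto
  next
    case False
    then have eqs: "n mod 4 = 0 \<Longrightarrow> 4 * (n div 4 - 1) + 4 = n" 
      "n mod 4 = 1 \<Longrightarrow> 4 * (n div 4 - 1) + 5 = n"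
      "n mod 4 = 2 \<Longrightarrow> 4 * (n div 4 - 1) + 6 = n"
      "n mod 4 \<noteq> 0 \<Longrightarrow> n mod 4 \<noteq> 1 \<Longrightarrow> n mod 4 \<noteq> 2 \<Longrightarrow> 4 * (n div 4 - 1) + 7 = n"
      by presburger+
    have "n \<noteq> 0" "n \<noteq> 1" "n \<noteq> 2" "n \<noteq> 3" using False by auto
    note IH = 1[OF this refl refl refl]
    show ?thesis
      using IH eqs \<open>n \<noteq> 0\<close> \<open>n \<noteq> 1\<close> \<open>n \<noteq> 2\<close> \<open>n \<noteq> 3\<close>
      by (subst decode.simps) (simp add: Let_def)
  qed
qed

definition computable :: "(nat \<Rightarrow> nat) \<Rightarrow> bool" where
  "computable h \<longleftrightarrow> (\<exists>c. \<forall>x. eval c x = Some (h x))"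

definition decidable :: "(nat \<Rightarrow> bool) \<Rightarrow> bool" where
  "decidable P \<longleftrightarrow> computable (\<lambda>x. if P x then 1 else 0)"

text \<open>
  The arithmetical hierarchy: \<open>Sigma0 n P\<close> says that \<open>P\<close> is a \<open>\<Sigma>\<^sup>0\<^sub>n\<close> predicate. \<open>Q\<close> is
  \<open>\<Pi>\<^sup>0\<^sub>n\<close> iff its negation is \<open>\<Sigma>\<^sup>0\<^sub>n\<close>, and \<open>\<Sigma>\<^sup>0\<close> at level \<open>n + 1\<close> is existential
  quantification over \<open>\<Pi>\<^sup>0\<^sub>n\<close>.
\<close>

primrec Sigma0 :: "nat \<Rightarrow> (nat \<Rightarrow> bool) \<Rightarrow> bool" where
  "Sigma0 0 P \<longleftrightarrow> decidable P"
| "Sigma0 (Suc n) P \<longleftrightarrow>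
    (\<exists>Q. Sigma0 n (\<lambda>z. \<not> Q z) \<and> (\<forall>e. P e \<longleftrightarrow> (\<exists>x. Q (prod_encode (e, x)))))"

definition W :: "nat \<Rightarrow> nat set" where
  "W e = {x. eval (decode e) x \<noteq> None}"

definition column :: "nat \<Rightarrow> nat \<Rightarrow> nat set" where
  "column e i = {x. prod_encode (i, x) \<in> W e}"

definition uce_family :: "nat \<Rightarrow> nat set set" where
  "uce_family e = range (column e)"

definition content :: "(nat \<Rightarrow> nat) \<Rightarrow> nat set" where
  "content f = {x. \<exists>n. f n = x}"

definition enumeration_of :: "(nat \<Rightarrow> nat) \<Rightarrow> nat set \<Rightarrow> bool" where
  "enumeration_of f A \<longleftrightarrow> content f = A"

definition initial_segment :: "(nat \<Rightarrow> nat) \<Rightarrow> nat \<Rightarrow> nat list" where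
  "initial_segment f i = map f [0..<i]"

definition learning_machine :: "(nat list \<Rightarrow> nat option) \<Rightarrow> bool" where
  "learning_machine M \<longleftrightarrow> (\<exists>c. \<forall>s. M s = eval c (list_encode s))"

definition TxtBC_identifies :: "(nat list \<Rightarrow> nat option) \<Rightarrow> (nat \<Rightarrow> nat) \<Rightarrow> bool" where
  "TxtBC_identifies M f \<longleftrightarrow>
    (\<exists>n. \<forall>i>n. \<exists>e. M (initial_segment f i) = Some e \<and> W e = content f)"

text \<open>
  An enumeration is a total function, so the empty set has none and is learned vacuously.
\<close>

definition TxtBC_learns_set :: "(nat list \<Rightarrow> nat option) \<Rightarrow> nat set \<Rightarrow> bool" where
  "TxtBC_learns_set M A \<longleftrightarrow> (\<forall>f. enumeration_of f A \<longrightarrow> TxtBC_identifies M f)"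

definition TxtBC_learns_family :: "(nat list \<Rightarrow> nat option) \<Rightarrow> nat set set \<Rightarrow> bool" where
  "TxtBC_learns_family M F \<longleftrightarrow> (\<forall>A\<in>F. TxtBC_learns_set M A)"

definition TxtBC_learnable :: "nat set set \<Rightarrow> bool" where
  "TxtBC_learnable F \<longleftrightarrow> (\<exists>M. learning_machine M \<and> TxtBC_learns_family M F)"

definition BCL :: "nat set" where
  "BCL = {e. TxtBC_learnable (uce_family e)}"

end

theory Submission
  imports Defs "HOL-Library.Infinite_Set"
begin

text \<open>
  Write \<open>P e\<close> as \<open>\<exists>k \<forall>a \<exists>b N\<close> with \<open>N\<close> in \<open>\<Pi>\<^sup>0\<^sub>2\<close>. Let \<open>w\<close> range over codes of lists of unique witnesses that
  \<open>k = 0, \<dots>, m - 1\<close> all fail. There are c.e. sets \<open>V\<^sub>w\<close> that are coinfinite iff \<open>w\<close> is such a list; if \<open>P e\<close>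
  holds there are finitely many coinfinite \<open>V\<^sub>w\<close>, otherwise there is one for every length \<open>m\<close>. For every \<open>w\<close>
  there is a family that defeats learning machine number \<open>m\<close> if \<open>V\<^sub>w\<close> is coinfinite and that is learned by an
  algorithm uniform in \<open>w\<close> if \<open>V\<^sub>w\<close> is cofinite. In the former case it is still learned with one number
  as advice, so the union of all families is learnable if only finitely many \<open>V\<^sub>w\<close> are coinfinite.

  The family consists of a language \<open>A\<close> and approximations \<open>L\<^sub>i\<close> that contain \<open>V\<^sub>w\<close> and only finitely many
  other numbers. That \<open>\<sigma>\<^sub>i\<close> behaves like a locking sequence of the machine for \<open>A\<close> is a \<open>\<Pi>\<^sup>0\<^sub>2\<close> condition, hence holds
  iff \<open>i\<close> acts at infinitely many stages. Whenever \<open>i\<close> acts, \<open>L\<^sub>i\<close> receives a new tag and \<open>A\<close> receives the old ones. So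
  if \<open>i\<close> acts forever then \<open>L\<^sub>i \<subset> A\<close> and the machine, locked on \<open>A\<close>, fails on \<open>L\<^sub>i\<close>; otherwise the last tag
  distinguishes \<open>L\<^sub>i\<close> from \<open>A\<close>. If nothing acts forever, then the machine has no locking sequence for \<open>A\<close> and fails on it.
\<close>

subsection \<open>Computable functions and decidable predicates\<close>

abbreviation pair :: "nat \<Rightarrow> nat \<Rightarrow> nat" (\<open>\<langle>_,/ _\<rangle>\<close>) where
  "\<langle>a, b\<rangle> \<equiv> prod_encode (a, b)"

abbreviation pfst :: "nat \<Rightarrow> nat" where "pfst z \<equiv> fst (prod_decode z)"
abbreviation psnd :: "nat \<Rightarrow> nat" where "psnd z \<equiv> snd (prod_decode z)"

lemma pair_pfst_psnd: "\<langle>pfst z, psnd z\<rangle> = z"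
  by (metis prod.collapse prod_decode_inverse)

lemma pair_cases: obtains a b where "z = \<langle>a, b\<rangle>"
  by (metis pair_pfst_psnd)

abbreviation IdC :: code where "IdC \<equiv> PairC FstC SndC"

primrec ConstC :: "nat \<Rightarrow> code" where
  "ConstC 0 = ZeroC"
| "ConstC (Suc n) = CompC SuccC (ConstC n)"

lemma eval_IdC: "eval IdC x = Some x"
  by (simp add: pair_pfst_psnd)

lemma eval_ConstC [simp]: "eval (ConstC n) x = Some n"
  by (induction n) auto

text \<open>Closure rules under which computability and decidability follow from the shape of a
  term; every rule passes the context \<open>z\<close> on, packed with bound variables into a
  pair.\<close>

named_theorems comp

lemma computable_id [comp]: "computable (\<lambda>z. z)"
  unfolding computable_def using eval_IdC by blast

lemma computable_const [comp]: "computable (\<lambda>z. n)"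
  unfolding computable_def using eval_ConstC by blast

lemma computable_comp:
  assumes "computable f" "computable g"
  shows "computable (\<lambda>z. f (g z))"
proof -
  obtain c d where "\<And>x. eval c x = Some (f x)" "\<And>x. eval d x = Some (g x)"
    using assms unfolding computable_def by metis
  then have "\<forall>x. eval (CompC c d) x = Some (f (g x))" by simp
  then show ?thesis unfolding computable_def by blast
qed

lemma computable_Suc [comp]: "computable f \<Longrightarrow> computable (\<lambda>z. Suc (f z))"
  by (rule computable_comp[of Suc]) (auto simp: computable_def intro: exI[of _ SuccC])

lemma computable_pfst [comp]: "computable f \<Longrightarrow> computable (\<lambda>z. pfst (f z))"
  by (rule computable_comp[of pfst]) (auto simp: computable_def intro: exI[of _ FstC])

lemma computable_psnd [comp]: "computable f \<Longrightarrow> computable (\<lambda>z. psnd (f z))"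
  by (rule computable_comp[of psnd]) (auto simp: computable_def intro: exI[of _ SndC])

lemma computable_pair [comp]:
  assumes "computable f" "computable g"
  shows "computable (\<lambda>z. \<langle>f z, g z\<rangle>)"
proof -
  obtain c d where "\<And>x. eval c x = Some (f x)" "\<And>x. eval d x = Some (g x)"
    using assms unfolding computable_def by metis
  then have "\<forall>x. eval (PairC c d) x = Some \<langle>f x, g x\<rangle>" by simp
  then show ?thesis unfolding computable_def by blast
qed

text \<open>\<open>PrecC\<close> keeps its parameter fixed during the recursion, so the whole
  context serves as parameter and only the recursion bound is computed from it. Hence start value
  and step may both depend on \<open>z\<close>.\<close>

lemma computable_rec_nat [comp]:
  assumes "computable f" "computable (\<lambda>y. g (pfst y) (pfst (psnd y)) (psnd (psnd y)))" "computable n"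
  shows "computable (\<lambda>z. rec_nat (f z) (g z) (n z))"
proof -
  obtain c d where c: "\<And>x. eval c x = Some (f x)"
    and d: "\<And>y. eval d y = Some (g (pfst y) (pfst (psnd y)) (psnd (psnd y)))"
    using assms(1,2) unfolding computable_def by metis
  have "rec_nat (Some u) (\<lambda>k r. Option.bind r (\<lambda>v. eval d \<langle>a, \<langle>k, v\<rangle>\<rangle>)) m
      = Some (rec_nat u (g a) m)" for u a m
    by (induction m) (simp_all add: d)
  then have "eval (PrecC c d) x = Some (rec_nat (f (pfst x)) (g (pfst x)) (psnd x))" for x
    by (simp add: c split: prod.split)
  then have "computable (\<lambda>x. rec_nat (f (pfst x)) (g (pfst x)) (psnd x))"
    unfolding computable_def by blast
  from computable_comp[OF this computable_pair[OF computable_id assms(3)]]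
  show ?thesis by simp
qed

lemma computable_add [comp]:
  assumes "computable f" "computable g" shows "computable (\<lambda>z. f z + g z)"
proof -
  have *: "a + b = rec_nat a (\<lambda>_ r. Suc r) b" for a b :: nat by (induction b) auto
  show ?thesis unfolding * by (intro comp assms)
qed

lemma computable_mult [comp]:
  assumes "computable f" "computable g" shows "computable (\<lambda>z. f z * g z)"
proof -
  have *: "a * b = rec_nat 0 (\<lambda>_ r. r + a) b" for a b :: nat by (induction b) auto
  show ?thesis unfolding * by (intro comp assms computable_comp[OF assms(1)])
qed

lemma computable_pred: "computable f \<Longrightarrow> computable (\<lambda>z. f z - 1)"
proof -
  assume f: "computable f"
  have *: "a - 1 = rec_nat 0 (\<lambda>k _. k) a" for a :: nat by (cases a) auto
  show ?thesis unfolding * by (intro comp f)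
qed

lemma computable_diff [comp]:
  assumes "computable f" "computable g" shows "computable (\<lambda>z. f z - g z)"
proof -
  have *: "rec_nat a (\<lambda>_ r. r - 1) b = a - b" for a b :: nat by (induction b) auto
  have "computable (\<lambda>z. rec_nat (f z) (\<lambda>_ r. r - 1) (g z))"
    by (intro comp assms computable_pred)
  then show ?thesis unfolding * .
qed

text \<open>With truth represented by the value 0, conjunctions and bounded universal quantifiers
  become sums, and \<open>MuC\<close> searches for truth.\<close>

lemma decidable_iff_zero: "decidable P \<longleftrightarrow> (\<exists>f. computable f \<and> (\<forall>z. P z \<longleftrightarrow> f z = 0))"
proof
  assume "decidable P"
  then have "computable (\<lambda>z. 1 - (if P z then 1 else 0))"
    unfolding decidable_def by (rule computable_diff[OF computable_const])
  then show "\<exists>f. computable f \<and> (\<forall>z. P z \<longleftrightarrow> f z = 0)"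
    by (intro exI[of _ "\<lambda>z. 1 - (if P z then 1 else 0)"]) auto
next
  assume "\<exists>f. computable f \<and> (\<forall>z. P z \<longleftrightarrow> f z = 0)"
  then obtain f where f: "computable f" "\<And>z. P z \<longleftrightarrow> f z = 0" by blast
  have "computable (\<lambda>z. 1 - f z)" by (intro comp f)
  moreover have "(\<lambda>z. 1 - f z) = (\<lambda>z. if P z then 1 else 0)" using f(2) by (auto simp: fun_eq_iff)
  ultimately show "decidable P" unfolding decidable_def by simp
qed

lemma decidableI: "computable f \<Longrightarrow> (\<And>z. P z \<longleftrightarrow> f z = 0) \<Longrightarrow> decidable P"
  unfolding decidable_iff_zero by blast

lemma decidableE:
  assumes "decidable P" obtains f where "computable f" "\<And>z. P z \<longleftrightarrow> f z = 0"
  using assms unfolding decidable_iff_zero by blast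

lemma decidable_le [comp]: "computable f \<Longrightarrow> computable g \<Longrightarrow> decidable (\<lambda>z. f z \<le> g z)"
  by (rule decidableI[of "\<lambda>z. f z - g z"]) (intro comp, auto)

lemma decidable_less [comp]: "computable f \<Longrightarrow> computable g \<Longrightarrow> decidable (\<lambda>z. f z < g z)"
  by (rule decidableI[of "\<lambda>z. Suc (f z) - g z"]) (intro comp, auto)

lemma decidable_eq [comp]: "computable f \<Longrightarrow> computable g \<Longrightarrow> decidable (\<lambda>z. f z = g z)"
  by (rule decidableI[of "\<lambda>z. (f z - g z) + (g z - f z)"]) (intro comp, auto)

lemma decidable_const [comp]: "decidable (\<lambda>z. b)"
  unfolding decidable_def by (rule computable_const)

lemma decidable_not [comp]:
  assumes "decidable P" shows "decidable (\<lambda>z. \<not> P z)"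
proof -
  obtain f where "computable f" "\<And>z. P z \<longleftrightarrow> f z = 0" using assms decidable_iff_zero by auto
  then show ?thesis by (intro decidableI[of "\<lambda>z. 1 - f z"] comp) auto
qed

lemma decidable_conj [comp]:
  assumes "decidable P" "decidable Q" shows "decidable (\<lambda>z. P z \<and> Q z)"
proof -
  obtain f g where "computable f" "\<And>z. P z \<longleftrightarrow> f z = 0" "computable g" "\<And>z. Q z \<longleftrightarrow> g z = 0"
    using assms by (metis decidableE)
  then show ?thesis by (intro decidableI[of "\<lambda>z. f z + g z"] comp) auto
qed

lemma decidable_disj [comp]:
  assumes "decidable P" "decidable Q" shows "decidable (\<lambda>z. P z \<or> Q z)"
  using decidable_not[OF decidable_conj[OF assms[THEN decidable_not]]] by simp

lemma decidable_subst:
  assumes "decidable P" "computable f" shows "decidable (\<lambda>z. P (f z))"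
  using computable_comp[OF assms(1)[unfolded decidable_def] assms(2)] unfolding decidable_def .

lemma computable_if [comp]:
  assumes "decidable P" "computable f" "computable g"
  shows "computable (\<lambda>z. if P z then f z else g z)"
proof -
  obtain p where p: "computable p" "\<And>z. P z \<longleftrightarrow> p z = 0" using assms(1) decidable_iff_zero by auto
  have *: "(if P z then f z else g z) = rec_nat (f z) (\<lambda>k r. g z) (p z)" for z
    by (cases "p z") (simp_all add: p(2))
  show ?thesis unfolding * by (intro comp p assms computable_comp[OF assms(3)])
qed

section \<open>Bounded quantifiers, search and division\<close>

lemma decidable_ball_less [comp]:
  assumes "decidable (\<lambda>y. P (pfst y) (psnd y))" "computable f"
  shows "decidable (\<lambda>z. \<forall>n<f z. P z n)"
proof -
  obtain p where p: "computable p" "\<And>y. P (pfst y) (psnd y) \<longleftrightarrow> p y = 0"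
    using assms(1) decidable_iff_zero by auto
  have P: "P z n \<longleftrightarrow> p \<langle>z, n\<rangle> = 0" for z n using p(2)[of "\<langle>z, n\<rangle>"] by simp
  have *: "(\<forall>n<m. P z n) \<longleftrightarrow> rec_nat 0 (\<lambda>k r. r + p \<langle>z, k\<rangle>) m = 0" for z m
    by (induction m) (auto simp: P less_Suc_eq)
  show ?thesis unfolding * by (intro comp assms(2) computable_comp[OF p(1)])
qed

lemma decidable_ball_le [comp]:
  assumes "decidable (\<lambda>y. P (pfst y) (psnd y))" "computable f"
  shows "decidable (\<lambda>z. \<forall>n\<le>f z. P z n)"
  using decidable_ball_less[OF assms(1) computable_Suc[OF assms(2)]] by (simp add: less_Suc_eq_le)

lemma decidable_bex_less [comp]:
  assumes "decidable (\<lambda>y. P (pfst y) (psnd y))" "computable f"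
  shows "decidable (\<lambda>z. \<exists>n<f z. P z n)"
  using decidable_not[OF decidable_ball_less[OF decidable_not[OF assms(1)] assms(2)]] by simp

lemma decidable_bex_le [comp]:
  assumes "decidable (\<lambda>y. P (pfst y) (psnd y))" "computable f"
  shows "decidable (\<lambda>z. \<exists>n\<le>f z. P z n)"
  using decidable_bex_less[OF assms(1) computable_Suc[OF assms(2)]] by (simp add: less_Suc_eq_le)

text \<open>The test is total, so the demand of \<open>MuC\<close> that all earlier values be
  defined and positive reduces to the existence of a zero.\<close>

lemma ex_MuC:
  assumes "decidable P"
  shows "\<exists>c. \<forall>x. eval c x = (if \<exists>n. P \<langle>x, n\<rangle> then Some (LEAST n. P \<langle>x, n\<rangle>) else None)"
proof -
  obtain p where p: "computable p" "\<And>y. P y \<longleftrightarrow> p y = 0" using assms decidable_iff_zero by auto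
  obtain c where c: "\<And>x. eval c x = Some (p x)" using p(1) unfolding computable_def by blast
  have "(\<exists>n. p \<langle>x, n\<rangle> = 0 \<and> (\<forall>m<n. 0 < p \<langle>x, m\<rangle>)) \<longleftrightarrow> (\<exists>n. p \<langle>x, n\<rangle> = 0)" for x
    using exists_least_iff[of "\<lambda>n. p \<langle>x, n\<rangle> = 0"] by auto
  then have "eval (MuC c) x = (if \<exists>n. P \<langle>x, n\<rangle> then Some (LEAST n. P \<langle>x, n\<rangle>) else None)" for x
    by (simp add: c p(2))
  then show ?thesis by blast
qed

lemma computable_Least [comp]:
  assumes "decidable (\<lambda>y. P (pfst y) (psnd y))" "\<And>z. \<exists>n. P z n"
  shows "computable (\<lambda>z. LEAST n. P z n)"
  using ex_MuC[OF assms(1)] assms(2) unfolding computable_def by auto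

lemma computable_div [comp]:
  assumes "computable f" "computable g" shows "computable (\<lambda>z. f z div g z)"
proof -
  \<comment> \<open>The disjunct \<open>b = 0\<close> makes the search succeed for all arguments, as
    \<open>computable_Least\<close> demands.\<close>
  have "a div b = (if b = 0 then 0 else LEAST q. a < Suc q * b \<or> b = 0)" for a b :: nat
  proof (cases "b = 0")
    case False
    have "(LEAST q. a < Suc q * b) = a div b"
    proof (rule Least_equality)
      show "a < Suc (a div b) * b" using False by (simp add: dividend_less_div_times)
      show "a div b \<le> q" if "a < Suc q * b" for q
        using that less_mult_imp_div_less[OF that] by simp
    qed
    with False show ?thesis by simp
  qed simp
  note * = this
  have ex: "\<exists>q. f z < Suc q * g z \<or> g z = 0" for z
    by (cases "g z") (auto intro!: exI[of _ "f z"])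
  show ?thesis
    unfolding * by (intro comp assms ex computable_comp[OF assms(1)] computable_comp[OF assms(2)])
qed

lemma computable_mod [comp]:
  "computable f \<Longrightarrow> computable g \<Longrightarrow> computable (\<lambda>z. f z mod g z)"
  unfolding modulo_nat_def by (intro comp)

text \<open>Makes advice that is nonzero for only finitely many families available to a single
  learning machine.\<close>

lemma computable_finite_support:
  assumes "finite {w. q w \<noteq> (0::nat)}" shows "computable q"
proof -
  have "computable (\<lambda>w. if w \<in> F then q w else 0)" if "finite F" for F
    using that
  proof induction
    case (insert v F)
    have "(\<lambda>w. if w \<in> insert v F then q w else 0) = (\<lambda>w. if w = v then q v else if w \<in> F then q w else 0)"
      by auto
    then show ?case using insert by (auto intro!: comp)
  qed (auto intro: comp)
  moreover have "(\<lambda>w. if w \<in> {w. q w \<noteq> 0} then q w else 0) = q" by auto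
  ultimately show ?thesis using assms by metis
qed

subsection \<open>Coded lists\<close>

text \<open>A nonempty list is coded as the successor of the pair of its head and the code of its
  tail, so \<open>psnd (r - 1)\<close> is the tail; it maps the code 0 of the empty list to
  itself.\<close>

definition code_drop :: "nat \<Rightarrow> nat \<Rightarrow> nat" where
  "code_drop u k = rec_nat u (\<lambda>_ r. psnd (r - 1)) k"

definition code_length :: "nat \<Rightarrow> nat" where
  "code_length u = length (list_decode u)"

text \<open>Out of range, \<open>code_nth\<close> returns the junk value 0.\<close>

definition code_nth :: "nat \<Rightarrow> nat \<Rightarrow> nat" where
  "code_nth u k = pfst (code_drop u k - 1)"

lemma prod_decode_0: "prod_decode 0 = (0, 0)"
  by (metis prod_encode_inverse le_zero_eq le_prod_encode_1 le_prod_encode_2 pair_cases)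

lemma list_decode_code_drop: "list_decode (code_drop u k) = drop k (list_decode u)"
proof (induction k)
  case (Suc k)
  have "list_decode (psnd (r - 1)) = tl (list_decode r)" for r
    by (cases r) (simp_all add: prod_decode_0 split: prod.split)
  with Suc show ?case by (simp add: code_drop_def drop_Suc tl_drop)
qed (simp add: code_drop_def)

lemma code_drop_eq_0_iff: "code_drop u k = 0 \<longleftrightarrow> code_length u \<le> k"
  using list_decode_eq[of "code_drop u k" 0] by (simp add: list_decode_code_drop code_length_def)

lemma code_nth: "k < code_length u \<Longrightarrow> code_nth u k = list_decode u ! k"
proof -
  assume k: "k < code_length u"
  then obtain r where r: "code_drop u k = Suc r"
    using code_drop_eq_0_iff[of u k] by (cases "code_drop u k") auto
  have "list_decode (Suc r) ! 0 = list_decode u ! k"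
    using k by (simp add: list_decode_code_drop flip: r) (simp add: code_length_def)
  then show ?thesis by (simp add: code_nth_def r split: prod.splits)
qed

lemma code_length_eq: "code_length u = (LEAST k. code_drop u k = 0)"
  by (rule sym, rule Least_equality) (auto simp: code_drop_eq_0_iff)

lemma computable_code_drop [comp]:
  "computable f \<Longrightarrow> computable g \<Longrightarrow> computable (\<lambda>z. code_drop (f z) (g z))"
  unfolding code_drop_def by (intro comp)

lemma computable_code_length [comp]:
  assumes "computable f" shows "computable (\<lambda>z. code_length (f z))"
  unfolding code_length_eq
  by (intro comp computable_comp[OF assms]) (auto simp: code_drop_eq_0_iff)

lemma computable_code_nth [comp]:
  "computable f \<Longrightarrow> computable g \<Longrightarrow> computable (\<lambda>z. code_nth (f z) (g z))"
  unfolding code_nth_def by (intro comp)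

lemma code_mem_iff: "x \<in> set (list_decode u) \<longleftrightarrow> (\<exists>k<code_length u. code_nth u k = x)"
  unfolding in_set_conv_nth by (auto simp: code_nth code_length_def)

lemma decidable_code_mem [comp]:
  assumes "computable f" "computable g" shows "decidable (\<lambda>z. f z \<in> set (list_decode (g z)))"
  unfolding code_mem_iff
  by (intro comp assms computable_comp[OF assms(1)] computable_comp[OF assms(2)])

lemma ex_code_nth: "\<exists>u. code_length u = m \<and> (\<forall>k<m. code_nth u k = f k)"
  by (rule exI[of _ "list_encode (map f [0..<m])"]) (auto simp: code_length_def code_nth)

lemma mem_le_code: "x \<in> set (list_decode u) \<Longrightarrow> x \<le> u"
proof -
  have "x \<in> set xs \<Longrightarrow> x \<le> list_encode xs" for xs
    by (induction xs) (auto intro: le_SucI le_prod_encode_1 order_trans[OF _ le_prod_encode_2])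
  from this[of "list_decode u"] show "x \<in> set (list_decode u) \<Longrightarrow> x \<le> u" by simp
qed

lemma decidable_ball_mem [comp]:
  assumes "decidable (\<lambda>y. P (pfst y) (psnd y))" "computable f"
  shows "decidable (\<lambda>z. \<forall>x\<in>set (list_decode (f z)). P z x)"
proof -
  have *: "(\<forall>x\<in>set (list_decode (f z)). P z x) \<longleftrightarrow> (\<forall>k<code_length (f z). P z (code_nth (f z) k))" for z
    by (auto simp: code_mem_iff Ball_def)
  have "decidable (\<lambda>y. P (pfst y) (code_nth (f (pfst y)) (psnd y)))"
    using decidable_subst[OF assms(1), of "\<lambda>y. \<langle>pfst y, code_nth (f (pfst y)) (psnd y)\<rangle>"]
    by (simp add: comp computable_comp[OF assms(2)])
  then show ?thesis unfolding * by (intro comp assms(2))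
qed

lemma decidable_bex_mem [comp]:
  assumes "decidable (\<lambda>y. P (pfst y) (psnd y))" "computable f"
  shows "decidable (\<lambda>z. \<exists>x\<in>set (list_decode (f z)). P z x)"
  using decidable_not[OF decidable_ball_mem[OF decidable_not[OF assms(1)] assms(2)]] by simp

subsection \<open>The arithmetical hierarchy\<close>

named_theorems arith

lemma Sigma0_SucI:
  "Sigma0 n (\<lambda>z. \<not> Q z) \<Longrightarrow> (\<And>e. P e \<longleftrightarrow> (\<exists>x. Q \<langle>e, x\<rangle>)) \<Longrightarrow> Sigma0 (Suc n) P"
  by auto

lemma Sigma0_SucE:
  assumes "Sigma0 (Suc n) P"
  obtains Q where "Sigma0 n (\<lambda>z. \<not> Q z)" "\<And>e. P e \<longleftrightarrow> (\<exists>x. Q \<langle>e, x\<rangle>)"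
  using assms by auto

lemma Sigma0_subst:
  "Sigma0 n P \<Longrightarrow> computable f \<Longrightarrow> Sigma0 n (\<lambda>z. P (f z))"
proof (induction n arbitrary: P f)
  case 0
  then show ?case using decidable_subst by simp
next
  case (Suc n)
  from Suc.prems(1) obtain Q where Q: "Sigma0 n (\<lambda>z. \<not> Q z)" "\<And>e. P e \<longleftrightarrow> (\<exists>x. Q \<langle>e, x\<rangle>)"
    by (rule Sigma0_SucE) blast
  show ?case
    by (rule Sigma0_SucI[OF Suc.IH[OF Q(1), of "\<lambda>y. \<langle>f (pfst y), psnd y\<rangle>"]])
      (intro comp computable_comp[OF Suc.prems(2)], simp add: Q(2))
qed

lemma Sigma0_Suc_if_Pi0: "Sigma0 n (\<lambda>z. \<not> P z) \<Longrightarrow> Sigma0 (Suc n) P"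
  by (rule Sigma0_SucI[OF Sigma0_subst[of n "\<lambda>z. \<not> P z" pfst]]) (auto intro: comp)

lemma Sigma0_Suc_if_Sigma0: "Sigma0 n P \<Longrightarrow> Sigma0 (Suc n) P"
proof (induction n arbitrary: P)
  case 0
  then show ?case by (intro Sigma0_Suc_if_Pi0) (simp add: decidable_not)
next
  case (Suc n)
  from Suc.prems obtain Q where Q: "Sigma0 n (\<lambda>z. \<not> Q z)" "\<And>e. P e \<longleftrightarrow> (\<exists>x. Q \<langle>e, x\<rangle>)"
    by (rule Sigma0_SucE) blast
  show ?case by (rule Sigma0_SucI[OF Suc.IH[OF Q(1)] Q(2)])
qed

lemma Sigma0_decidable: "decidable P \<Longrightarrow> Sigma0 n P"
  by (induction n) (simp_all only: Sigma0.simps(1) Sigma0_Suc_if_Sigma0)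

lemmas [arith] =
  decidable_eq[THEN Sigma0_decidable]
  decidable_less[THEN Sigma0_decidable] decidable_le[THEN Sigma0_decidable]
  decidable_code_mem[THEN Sigma0_decidable]

text \<open>Both connectives share one induction because matrices are given through their negations:
  by de Morgan, each connective at level \<open>Suc n\<close> uses the other one at level
  \<open>n\<close>.\<close>

lemma Sigma0_conj_disj:
  "Sigma0 n P \<Longrightarrow> Sigma0 n Q \<Longrightarrow> Sigma0 n (\<lambda>z. P z \<and> Q z) \<and> Sigma0 n (\<lambda>z. P z \<or> Q z)"
proof (induction n arbitrary: P Q)
  case 0
  then show ?case by (simp add: decidable_conj decidable_disj)
next
  case (Suc n)
  from Suc.prems obtain P' Q' where
      P': "Sigma0 n (\<lambda>z. \<not> P' z)" "\<And>e. P e \<longleftrightarrow> (\<exists>x. P' \<langle>e, x\<rangle>)" and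
      Q': "Sigma0 n (\<lambda>z. \<not> Q' z)" "\<And>e. Q e \<longleftrightarrow> (\<exists>x. Q' \<langle>e, x\<rangle>)"
    by (elim Sigma0_SucE) blast
  have "Sigma0 n (\<lambda>y. \<not> P' \<langle>pfst y, pfst (psnd y)\<rangle>)"
    by (rule Sigma0_subst[OF P'(1)]) (intro comp)
  moreover have "Sigma0 n (\<lambda>y. \<not> Q' \<langle>pfst y, psnd (psnd y)\<rangle>)"
    by (rule Sigma0_subst[OF Q'(1)]) (intro comp)
  ultimately have "Sigma0 n (\<lambda>y. \<not> P' \<langle>pfst y, pfst (psnd y)\<rangle> \<or> \<not> Q' \<langle>pfst y, psnd (psnd y)\<rangle>)"
    using Suc.IH by blast
  then have "Sigma0 (Suc n) (\<lambda>z. P z \<and> Q z)"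
    by (intro Sigma0_SucI[of n "\<lambda>y. P' \<langle>pfst y, pfst (psnd y)\<rangle> \<and> Q' \<langle>pfst y, psnd (psnd y)\<rangle>"])
      (auto simp: P'(2) Q'(2), metis fst_conv snd_conv prod_encode_inverse)
  moreover have "Sigma0 (Suc n) (\<lambda>z. P z \<or> Q z)"
    using Suc.IH[OF P'(1) Q'(1)]
    by (intro Sigma0_SucI[of n "\<lambda>y. P' y \<or> Q' y"]) (auto simp: P'(2) Q'(2))
  ultimately show ?case by blast
qed

lemma Sigma0_conj [arith]: "Sigma0 n P \<Longrightarrow> Sigma0 n Q \<Longrightarrow> Sigma0 n (\<lambda>z. P z \<and> Q z)"
  and Sigma0_disj [arith]: "Sigma0 n P \<Longrightarrow> Sigma0 n Q \<Longrightarrow> Sigma0 n (\<lambda>z. P z \<or> Q z)"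
  using Sigma0_conj_disj by auto

lemma Sigma0_ex [arith]:
  assumes "Sigma0 (Suc n) (\<lambda>y. P (pfst y) (psnd y))"
  shows "Sigma0 (Suc n) (\<lambda>z. \<exists>x. P z x)"
proof -
  obtain Q where Q: "Sigma0 n (\<lambda>z. \<not> Q z)" "\<And>e. P (pfst e) (psnd e) \<longleftrightarrow> (\<exists>x. Q \<langle>e, x\<rangle>)"
    using assms by (rule Sigma0_SucE) blast
  have "P z x \<longleftrightarrow> (\<exists>y. Q \<langle>\<langle>z, x\<rangle>, y\<rangle>)" for z x using Q(2)[of "\<langle>z, x\<rangle>"] by simp
  then show ?thesis
    by (intro Sigma0_SucI[OF Sigma0_subst[OF Q(1)],
          of "\<lambda>y. \<langle>\<langle>pfst y, pfst (psnd y)\<rangle>, psnd (psnd y)\<rangle>"])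
      (intro comp, simp, metis fst_conv snd_conv prod_encode_inverse)
qed

text \<open>Collection: a list of witnesses turns a bounded \<open>\<forall>\<close> over \<open>\<exists>\<close> into \<open>\<exists>\<close> over a bounded \<open>\<forall>\<close>.\<close>

lemma Sigma0_bounded:
  "Sigma0 n P \<Longrightarrow> computable f \<Longrightarrow>
    Sigma0 n (\<lambda>z. \<forall>k<f z. P \<langle>z, k\<rangle>) \<and> Sigma0 n (\<lambda>z. \<exists>k<f z. P \<langle>z, k\<rangle>)"
proof (induction n arbitrary: P f)
  case 0
  then show ?case
    by (simp add: decidable_ball_less decidable_bex_less pair_pfst_psnd)
next
  case (Suc n)
  from Suc.prems(1) obtain Q where Q: "Sigma0 n (\<lambda>z. \<not> Q z)" "\<And>e. P e \<longleftrightarrow> (\<exists>x. Q \<langle>e, x\<rangle>)"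
    by (rule Sigma0_SucE) blast
  note f = Suc.prems(2)
  have "Sigma0 n (\<lambda>y. \<not> Q \<langle>\<langle>pfst (pfst y), psnd y\<rangle>, code_nth (psnd (pfst y)) (psnd y)\<rangle>)"
    by (rule Sigma0_subst[OF Q(1)]) (intro comp)
  from conjunct2[OF Suc.IH[OF this computable_comp[OF f computable_pfst[OF computable_id]]]]
  have "Sigma0 n (\<lambda>y. \<not> (\<forall>k<f (pfst y). Q \<langle>\<langle>pfst y, k\<rangle>, code_nth (psnd y) k\<rangle>))"
    by simp
  then have "Sigma0 (Suc n) (\<lambda>z. \<forall>k<f z. P \<langle>z, k\<rangle>)"
  proof (rule Sigma0_SucI)
    fix z
    show "(\<forall>k<f z. P \<langle>z, k\<rangle>) \<longleftrightarrow>
      (\<exists>u. \<forall>k<f (pfst \<langle>z, u\<rangle>). Q \<langle>\<langle>pfst \<langle>z, u\<rangle>, k\<rangle>, code_nth (psnd \<langle>z, u\<rangle>) k\<rangle>)"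
    proof
      assume "\<forall>k<f z. P \<langle>z, k\<rangle>"
      then obtain g where g: "\<And>k. k < f z \<Longrightarrow> Q \<langle>\<langle>z, k\<rangle>, g k\<rangle>" unfolding Q(2) by metis
      obtain u where "\<forall>k<f z. code_nth u k = g k" using ex_code_nth[of "f z" g] by blast
      with g show "\<exists>u. \<forall>k<f (pfst \<langle>z, u\<rangle>). Q \<langle>\<langle>pfst \<langle>z, u\<rangle>, k\<rangle>, code_nth (psnd \<langle>z, u\<rangle>) k\<rangle>"
        by (intro exI[of _ u]) simp
    qed (auto simp: Q(2))
  qed
  moreover
  have "Sigma0 n (\<lambda>y. \<not> Q \<langle>\<langle>pfst (pfst y), psnd y\<rangle>, psnd (pfst y)\<rangle>)"
    by (rule Sigma0_subst[OF Q(1)]) (intro comp)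
  from conjunct1[OF Suc.IH[OF this computable_comp[OF f computable_pfst[OF computable_id]]]]
  have "Sigma0 n (\<lambda>y. \<not> (\<exists>k<f (pfst y). Q \<langle>\<langle>pfst y, k\<rangle>, psnd y\<rangle>))"
    by simp
  then have "Sigma0 (Suc n) (\<lambda>z. \<exists>k<f z. P \<langle>z, k\<rangle>)"
    by (rule Sigma0_SucI) (auto simp: Q(2))
  ultimately show ?case by blast
qed

lemma Sigma0_ball_less [arith]:
    "Sigma0 n (\<lambda>y. P (pfst y) (psnd y)) \<Longrightarrow> computable f \<Longrightarrow> Sigma0 n (\<lambda>z. \<forall>k<f z. P z k)"
  and Sigma0_bex_less [arith]:
    "Sigma0 n (\<lambda>y. P (pfst y) (psnd y)) \<Longrightarrow> computable f \<Longrightarrow> Sigma0 n (\<lambda>z. \<exists>k<f z. P z k)"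
  using Sigma0_bounded[of n "\<lambda>y. P (pfst y) (psnd y)"] by auto

lemma Sigma0_ball_mem [arith]:
  assumes "Sigma0 n (\<lambda>y. P (pfst y) (psnd y))" "computable f"
  shows "Sigma0 n (\<lambda>z. \<forall>x\<in>set (list_decode (f z)). P z x)"
proof -
  have *: "(\<forall>x\<in>set (list_decode (f z)). P z x) \<longleftrightarrow> (\<forall>k<code_length (f z). P z (code_nth (f z) k))" for z
    by (auto simp: code_mem_iff Ball_def)
  have "Sigma0 n (\<lambda>y. P (pfst y) (code_nth (f (pfst y)) (psnd y)))"
    using Sigma0_subst[OF assms(1), of "\<lambda>y. \<langle>pfst y, code_nth (f (pfst y)) (psnd y)\<rangle>"]
    by (simp add: comp computable_comp[OF assms(2)])
  then show ?thesis unfolding * by (intro arith comp assms(2))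
qed

subsection \<open>The universal function\<close>

text \<open>
  A triple \<open>\<langle>e, \<langle>x, y\<rangle>\<rangle>\<close> states that program \<open>e\<close> maps \<open>x\<close> to \<open>y\<close>. It is justified by a set \<open>D\<close> of such
  triples if it follows from members of \<open>D\<close> by the clause of \<^const>\<open>eval\<close> for the outermost constructor
  of \<open>e\<close>. Every clause refers to a subprogram or, in \<^const>\<open>PrecC\<close>, to a smaller recursion argument, so
  sets justifying all their members contain only true triples.
\<close>

definition justified :: "nat set \<Rightarrow> nat \<Rightarrow> nat \<Rightarrow> nat \<Rightarrow> bool" where
  "justified D e x y \<longleftrightarrow>
    (if e = 0 then y = 0
     else if e = 1 then y = Suc x
     else if e = 2 then y = pfst x
     else if e = 3 then y = psnd x
     else if e mod 4 = 0 then
       \<langle>pfst (e div 4 - 1), \<langle>x, pfst y\<rangle>\<rangle> \<in> D \<and> \<langle>psnd (e div 4 - 1), \<langle>x, psnd y\<rangle>\<rangle> \<in> D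
     else if e mod 4 = 1 then
       \<exists>d\<in>D. pfst d = psnd (e div 4 - 1) \<and> pfst (psnd d) = x \<and>
         \<langle>pfst (e div 4 - 1), \<langle>psnd (psnd d), y\<rangle>\<rangle> \<in> D
     else if e mod 4 = 2 then
       (if psnd x = 0 then \<langle>pfst (e div 4 - 1), \<langle>pfst x, y\<rangle>\<rangle> \<in> D
        else \<exists>d\<in>D. pfst d = e \<and> pfst (psnd d) = \<langle>pfst x, psnd x - 1\<rangle> \<and>
          \<langle>psnd (e div 4 - 1), \<langle>\<langle>pfst x, \<langle>psnd x - 1, psnd (psnd d)\<rangle>\<rangle>, y\<rangle>\<rangle> \<in> D)
     else \<langle>e div 4 - 1, \<langle>\<langle>x, y\<rangle>, 0\<rangle>\<rangle> \<in> D \<and>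
       (\<forall>m<y. \<exists>d\<in>D. pfst d = e div 4 - 1 \<and> pfst (psnd d) = \<langle>x, m\<rangle> \<and> 0 < psnd (psnd d)))"

text \<open>In \<open>justified\<close>, intermediate values range over members of \<open>D\<close>,
  so that the quantifier is bounded and the notion decidable. Here the plain quantifier over values
  is recovered.\<close>

lemma bex_triple:
  "(\<exists>d\<in>D. pfst d = e \<and> pfst (psnd d) = x \<and> R (psnd (psnd d))) \<longleftrightarrow> (\<exists>u. \<langle>e, \<langle>x, u\<rangle>\<rangle> \<in> D \<and> R u)"
  by (metis fst_conv snd_conv prod_encode_inverse pair_pfst_psnd)

lemma justified_encode:
  "justified D (encode ZeroC) x y \<longleftrightarrow> y = 0"
  "justified D (encode SuccC) x y \<longleftrightarrow> y = Suc x"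
  "justified D (encode FstC) x y \<longleftrightarrow> y = pfst x"
  "justified D (encode SndC) x y \<longleftrightarrow> y = psnd x"
  "justified D (encode (PairC c d)) x y \<longleftrightarrow>
    \<langle>encode c, \<langle>x, pfst y\<rangle>\<rangle> \<in> D \<and> \<langle>encode d, \<langle>x, psnd y\<rangle>\<rangle> \<in> D"
  "justified D (encode (CompC c d)) x y \<longleftrightarrow>
    (\<exists>u. \<langle>encode d, \<langle>x, u\<rangle>\<rangle> \<in> D \<and> \<langle>encode c, \<langle>u, y\<rangle>\<rangle> \<in> D)"
  "justified D (encode (PrecC c d)) \<langle>x, 0\<rangle> y \<longleftrightarrow> \<langle>encode c, \<langle>x, y\<rangle>\<rangle> \<in> D"
  "justified D (encode (PrecC c d)) \<langle>x, Suc n\<rangle> y \<longleftrightarrow>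
    (\<exists>u. \<langle>encode (PrecC c d), \<langle>\<langle>x, n\<rangle>, u\<rangle>\<rangle> \<in> D \<and> \<langle>encode d, \<langle>\<langle>x, \<langle>n, u\<rangle>\<rangle>, y\<rangle>\<rangle> \<in> D)"
  "justified D (encode (MuC c)) x y \<longleftrightarrow>
    \<langle>encode c, \<langle>\<langle>x, y\<rangle>, 0\<rangle>\<rangle> \<in> D \<and> (\<forall>m<y. \<exists>u. \<langle>encode c, \<langle>\<langle>x, m\<rangle>, u\<rangle>\<rangle> \<in> D \<and> 0 < u)"
proof -
  have 0: "(4 * p + 4) div 4 = p + 1" "(4 * p + 4) mod 4 = 0"
    "(4 * p + 5) div 4 = p + 1" "(4 * p + 5) mod 4 = 1"
    "(4 * p + 6) div 4 = p + 1" "(4 * p + 6) mod 4 = 2"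
    "(4 * p + 7) div 4 = p + 1" "(4 * p + 7) mod 4 = 3" for p :: nat by presburger+
  show
    "justified D (encode ZeroC) x y \<longleftrightarrow> y = 0"
    "justified D (encode SuccC) x y \<longleftrightarrow> y = Suc x"
    "justified D (encode FstC) x y \<longleftrightarrow> y = pfst x"
    "justified D (encode SndC) x y \<longleftrightarrow> y = psnd x"
    "justified D (encode (PairC c d)) x y \<longleftrightarrow>
      \<langle>encode c, \<langle>x, pfst y\<rangle>\<rangle> \<in> D \<and> \<langle>encode d, \<langle>x, psnd y\<rangle>\<rangle> \<in> D"
    "justified D (encode (CompC c d)) x y \<longleftrightarrow>
      (\<exists>u. \<langle>encode d, \<langle>x, u\<rangle>\<rangle> \<in> D \<and> \<langle>encode c, \<langle>u, y\<rangle>\<rangle> \<in> D)"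
    "justified D (encode (PrecC c d)) \<langle>x, 0\<rangle> y \<longleftrightarrow> \<langle>encode c, \<langle>x, y\<rangle>\<rangle> \<in> D"
    "justified D (encode (PrecC c d)) \<langle>x, Suc n\<rangle> y \<longleftrightarrow>
      (\<exists>u. \<langle>encode (PrecC c d), \<langle>\<langle>x, n\<rangle>, u\<rangle>\<rangle> \<in> D \<and> \<langle>encode d, \<langle>\<langle>x, \<langle>n, u\<rangle>\<rangle>, y\<rangle>\<rangle> \<in> D)"
    "justified D (encode (MuC c)) x y \<longleftrightarrow>
      \<langle>encode c, \<langle>\<langle>x, y\<rangle>, 0\<rangle>\<rangle> \<in> D \<and> (\<forall>m<y. \<exists>u. \<langle>encode c, \<langle>\<langle>x, m\<rangle>, u\<rangle>\<rangle> \<in> D \<and> 0 < u)"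
    by (simp_all add: justified_def 0 bex_triple bex_triple[of D _ x "\<lambda>u. \<langle>encode c, \<langle>u, y\<rangle>\<rangle> \<in> D"]
        bex_triple[of D _ "\<langle>x, n\<rangle>" "\<lambda>u. \<langle>encode d, \<langle>\<langle>x, \<langle>n, u\<rangle>\<rangle>, y\<rangle>\<rangle> \<in> D"])
qed

definition closed_derivation :: "nat set \<Rightarrow> bool" where
  "closed_derivation D \<longleftrightarrow> (\<forall>d\<in>D. justified D (pfst d) (pfst (psnd d)) (psnd (psnd d)))"

lemma closed_derivation_sound:
  assumes "closed_derivation D"
  shows "\<langle>encode c, \<langle>x, y\<rangle>\<rangle> \<in> D \<Longrightarrow> eval c x = Some y"
proof (induction c arbitrary: x y)
  have J: "justified D e x y" if "\<langle>e, \<langle>x, y\<rangle>\<rangle> \<in> D" for e x y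
    using assms that unfolding closed_derivation_def by force
  {
    case ZeroC with J[OF this] show ?case by (simp only: justified_encode) simp
  next
    case SuccC with J[OF this] show ?case by (simp only: justified_encode) simp
  next
    case FstC with J[OF this] show ?case by (simp only: justified_encode) simp
  next
    case SndC with J[OF this] show ?case by (simp only: justified_encode) simp
  next
    case (PairC c d)
    from J[OF PairC.prems] have "eval c x = Some (pfst y)" "eval d x = Some (psnd y)"
      unfolding justified_encode using PairC.IH by auto
    then show ?case by (simp add: pair_pfst_psnd)
  next
    case (CompC c d)
    then show ?case using J[OF CompC.prems] unfolding justified_encode by auto
  next
    case (PrecC c d)
    have "eval (PrecC c d) \<langle>a, n\<rangle> = Some y" if "\<langle>encode (PrecC c d), \<langle>\<langle>a, n\<rangle>, y\<rangle>\<rangle> \<in> D" for a n y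
      using that
    proof (induction n arbitrary: y)
      case 0
      from PrecC.IH(1) J[OF 0] show ?case unfolding justified_encode by simp
    next
      case (Suc n)
      from J[OF Suc.prems] Suc.IH PrecC.IH(2) show ?case unfolding justified_encode by fastforce
    qed
    with PrecC.prems show ?case by (metis pair_cases)
  next
    case (MuC c)
    then have *: "eval c \<langle>x, y\<rangle> = Some 0" "\<And>m. m < y \<Longrightarrow> \<exists>u>0. eval c \<langle>x, m\<rangle> = Some u"
      using J[OF MuC.prems] unfolding justified_encode by blast+
    have "(LEAST n. eval c \<langle>x, n\<rangle> = Some 0) = y"
    proof (rule Least_equality)
      show "y \<le> m" if "eval c \<langle>x, m\<rangle> = Some 0" for m
        using that *(2)[of m] by (metis linorder_not_le option.inject less_irrefl)
    qed (rule *(1))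
    with * show ?case by auto
  }
qed

definition derivable :: "nat \<Rightarrow> bool" where
  "derivable d \<longleftrightarrow> (\<exists>D. finite D \<and> closed_derivation D \<and> d \<in> D)"

lemma justified_mono: "justified D e x y \<Longrightarrow> D \<subseteq> D' \<Longrightarrow> justified D' e x y"
  unfolding justified_def by (fastforce split: if_splits)

text \<open>By monotonicity of \<open>justified\<close>, the union of closed derivations of the
  premises stays closed when the new triple is added.\<close>

lemma derivableI:
  assumes "finite S" "\<And>s. s \<in> S \<Longrightarrow> derivable s" "justified S e x y"
  shows "derivable \<langle>e, \<langle>x, y\<rangle>\<rangle>"
proof -
  obtain D where D: "\<And>s. s \<in> S \<Longrightarrow> finite (D s) \<and> closed_derivation (D s) \<and> s \<in> D s"
    using assms(2) unfolding derivable_def by metis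
  let ?D = "insert \<langle>e, \<langle>x, y\<rangle>\<rangle> (\<Union>s\<in>S. D s)"
  have "justified ?D (pfst d) (pfst (psnd d)) (psnd (psnd d))" if "s \<in> S" "d \<in> D s" for s d
    by (rule justified_mono[of "D s"]) (use D that in \<open>auto simp: closed_derivation_def\<close>)
  moreover have "justified ?D e x y" by (rule justified_mono[OF assms(3)]) (use D in auto)
  ultimately have "closed_derivation ?D" unfolding closed_derivation_def by auto
  moreover have "finite ?D" using assms(1) D by auto
  ultimately show ?thesis unfolding derivable_def by blast
qed

lemma derivable_complete:
  "eval c x = Some y \<Longrightarrow> derivable \<langle>encode c, \<langle>x, y\<rangle>\<rangle>"
proof (induction c arbitrary: x y)
  case (PairC c d)
  then obtain u v where uv: "eval c x = Some u" "eval d x = Some v" "y = \<langle>u, v\<rangle>"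
    by (auto split: option.splits)
  show ?case
    by (rule derivableI[of "{\<langle>encode c, \<langle>x, u\<rangle>\<rangle>, \<langle>encode d, \<langle>x, v\<rangle>\<rangle>}"])
      (use PairC.IH uv in \<open>auto simp: justified_encode simp del: encode.simps\<close>)
next
  case (CompC c d)
  then obtain u where u: "eval d x = Some u" "eval c u = Some y"
    by (auto simp: bind_eq_Some_conv)
  show ?case
    by (rule derivableI[of "{\<langle>encode d, \<langle>x, u\<rangle>\<rangle>, \<langle>encode c, \<langle>u, y\<rangle>\<rangle>}"])
      (use CompC.IH u in \<open>auto simp: justified_encode simp del: encode.simps\<close>)
next
  case (PrecC c d)
  have "derivable \<langle>encode (PrecC c d), \<langle>\<langle>a, n\<rangle>, y\<rangle>\<rangle>" if "eval (PrecC c d) \<langle>a, n\<rangle> = Some y" for a n y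
    using that
  proof (induction n arbitrary: y)
    case 0
    then show ?case
      by (intro derivableI[of "{\<langle>encode c, \<langle>a, y\<rangle>\<rangle>}"])
        (use PrecC.IH(1) in \<open>auto simp: justified_encode simp del: encode.simps\<close>)
  next
    case (Suc n)
    then obtain v where v: "eval (PrecC c d) \<langle>a, n\<rangle> = Some v" "eval d \<langle>a, \<langle>n, v\<rangle>\<rangle> = Some y"
      by (auto simp: bind_eq_Some_conv)
    show ?case
      by (rule derivableI[of "{\<langle>encode (PrecC c d), \<langle>\<langle>a, n\<rangle>, v\<rangle>\<rangle>, \<langle>encode d, \<langle>\<langle>a, \<langle>n, v\<rangle>\<rangle>, y\<rangle>\<rangle>}"])
        (use Suc.IH[OF v(1)] PrecC.IH(2)[OF v(2)] in \<open>auto simp: justified_encode simp del: encode.simps\<close>)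
  qed
  with PrecC.prems show ?case by (metis pair_cases)
next
  case (MuC c)
  then have y: "y = (LEAST n. eval c \<langle>x, n\<rangle> = Some 0)" and
    ex: "\<exists>n. eval c \<langle>x, n\<rangle> = Some 0 \<and> (\<forall>m<n. \<exists>v>0. eval c \<langle>x, m\<rangle> = Some v)"
    by (auto split: if_splits)
  from ex obtain n where n: "eval c \<langle>x, n\<rangle> = Some 0" "\<forall>m<n. \<exists>v>0. eval c \<langle>x, m\<rangle> = Some v" by blast
  have "y \<le> n" unfolding y using n(1) by (rule Least_le)
  with n(2) obtain v where v: "\<And>m. m < y \<Longrightarrow> eval c \<langle>x, m\<rangle> = Some (v m) \<and> 0 < v m"
    by (metis less_le_trans)
  have "eval c \<langle>x, y\<rangle> = Some 0" unfolding y using n(1) by (rule LeastI)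
  then show ?case
    by (intro derivableI[of "insert \<langle>encode c, \<langle>\<langle>x, y\<rangle>, 0\<rangle>\<rangle> ((\<lambda>m. \<langle>encode c, \<langle>\<langle>x, m\<rangle>, v m\<rangle>\<rangle>) ` {..<y})"])
      (use MuC.IH v in \<open>auto simp: justified_encode simp del: encode.simps\<close>)
qed (rule derivableI[of "{}"]; simp add: justified_encode del: encode.simps; fail)+

text \<open>Soundness and completeness of derivations reduce evaluation to an unbounded search for a
  coded finite set whose closedness is decidable.\<close>

lemma eval_decode_iff:
  "eval (decode e) x = Some y \<longleftrightarrow>
    (\<exists>u. closed_derivation (set (list_decode u)) \<and> \<langle>e, \<langle>x, y\<rangle>\<rangle> \<in> set (list_decode u))"
proof
  assume "eval (decode e) x = Some y"
  from derivable_complete[OF this] obtain D where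
    "finite D" "closed_derivation D" "\<langle>e, \<langle>x, y\<rangle>\<rangle> \<in> D"
    unfolding derivable_def encode_decode by blast
  then show "\<exists>u. closed_derivation (set (list_decode u)) \<and> \<langle>e, \<langle>x, y\<rangle>\<rangle> \<in> set (list_decode u)"
    by (metis finite_list list_encode_inverse)
next
  assume "\<exists>u. closed_derivation (set (list_decode u)) \<and> \<langle>e, \<langle>x, y\<rangle>\<rangle> \<in> set (list_decode u)"
  then show "eval (decode e) x = Some y"
    by (metis closed_derivation_sound encode_decode)
qed

section \<open>Enumerability of the universal function, parameters and fixed points\<close>

lemma decidable_If:
  assumes "decidable P" "decidable Q" "decidable R"
  shows "decidable (\<lambda>z. if P z then Q z else R z)"
proof -
  have "decidable (\<lambda>z. (P z \<and> Q z) \<or> (\<not> P z \<and> R z))" by (intro comp assms)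
  moreover have "(\<lambda>z. (P z \<and> Q z) \<or> (\<not> P z \<and> R z)) = (\<lambda>z. if P z then Q z else R z)" by auto
  ultimately show ?thesis by simp
qed

lemma decidable_closed_derivation: "decidable (\<lambda>u. closed_derivation (set (list_decode u)))"
  unfolding closed_derivation_def justified_def by (intro comp decidable_If)

abbreviation ce :: "(nat \<Rightarrow> bool) \<Rightarrow> bool" where "ce \<equiv> Sigma0 (Suc 0)"

lemma ce_eval [arith]:
  assumes "computable e" "computable x" "computable y"
  shows "ce (\<lambda>z. eval (decode (e z)) (x z) = Some (y z))"
  unfolding eval_decode_iff
  by (intro arith Sigma0_decidable[OF decidable_subst[OF decidable_closed_derivation]] comp
      assms[THEN computable_comp])

lemma mem_W_iff: "x \<in> W e \<longleftrightarrow> (\<exists>y. eval (decode e) x = Some y)"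
  by (simp add: W_def)

lemma ce_mem_W [arith]:
  assumes "computable e" "computable x"
  shows "ce (\<lambda>z. x z \<in> W (e z))"
  unfolding mem_W_iff by (intro arith comp assms[THEN computable_comp])

text \<open>The search for a witness of \<open>P\<close> is preceded by a program that puts the
  constant \<open>z\<close> in front of the input. The code of \<open>ConstC z\<close> is primitive
  recursive in \<open>z\<close>, hence so is the code of the whole.\<close>

theorem smn:
  assumes "ce P"
  obtains g where "computable g" "\<And>z y. y \<in> W (g z) \<longleftrightarrow> P \<langle>z, y\<rangle>"
proof -
  obtain Q where Q: "Sigma0 0 (\<lambda>z. \<not> Q z)" "\<And>e. P e \<longleftrightarrow> (\<exists>x. Q \<langle>e, x\<rangle>)"
    using assms by (rule Sigma0_SucE) blast
  have "decidable Q" using decidable_not[of "\<lambda>z. \<not> Q z"] Q(1) by simp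
  then obtain c where c: "\<And>x. eval c x = (if \<exists>n. Q \<langle>x, n\<rangle> then Some (LEAST n. Q \<langle>x, n\<rangle>) else None)"
    using ex_MuC by blast
  let ?g = "\<lambda>z. encode (CompC c (PairC (ConstC z) IdC))"
  have const: "encode (ConstC z) = rec_nat 0 (\<lambda>_ r. 4 * \<langle>1, r\<rangle> + 5) z" for z
    by (induction z) simp_all
  have "computable ?g" unfolding encode.simps(6) encode.simps(5)[of "ConstC _"] const by (intro comp)
  moreover have "y \<in> W (?g z) \<longleftrightarrow> P \<langle>z, y\<rangle>" for z y
    by (simp add: W_def decode_encode c Q(2) pair_pfst_psnd del: encode.simps)
  ultimately show thesis by (rule that)
qed

theorem recursion_theorem:
  assumes "ce P"
  obtains a where "computable a" "\<And>z y. y \<in> W (a z) \<longleftrightarrow> P \<langle>\<langle>z, a z\<rangle>, y\<rangle>"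
proof -
  have "ce (\<lambda>y. \<langle>psnd (pfst y), psnd y\<rangle> \<in> W (pfst (pfst y)))" by (intro arith comp)
  then obtain s where s: "computable s" "\<And>v w y. y \<in> W (s \<langle>v, w\<rangle>) \<longleftrightarrow> \<langle>w, y\<rangle> \<in> W v"
    by (rule smn) (metis fst_conv snd_conv prod_encode_inverse)
  let ?f = "\<lambda>y. \<langle>\<langle>psnd (pfst (psnd y)), s \<langle>pfst (pfst (psnd y)), pfst (psnd y)\<rangle>\<rangle>, psnd (psnd y)\<rangle>"
  have "ce (\<lambda>y. P (?f y))"
    by (rule Sigma0_subst[OF assms]) (intro comp computable_comp[OF s(1)])
  then obtain g where g: "\<And>z y. y \<in> W (g z) \<longleftrightarrow> P (?f \<langle>z, y\<rangle>)"
    by (rule smn) blast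
  show thesis
    \<comment> \<open>Self-application: \<open>g 0\<close> indexes the set of all
      \<open>\<langle>\<langle>v, z\<rangle>, y\<rangle>\<close> such that \<open>P\<close> holds of
      \<open>z\<close>, the index \<open>s \<langle>v, \<langle>v, z\<rangle>\<rangle>\<close> and
      \<open>y\<close>; taking \<open>v\<close> to be \<open>g 0\<close> itself yields the fixed
      point. The argument 0 of \<open>g\<close> is a dummy.\<close>
    by (rule that[of "\<lambda>z. s \<langle>g 0, \<langle>g 0, z\<rangle>\<rangle>"]) (intro comp computable_comp[OF s(1)], simp add: s(2) g)
qed

subsection \<open>Normal forms\<close>

lemma infinite_range_pair: "infinite (range (\<lambda>k. \<langle>k, s k\<rangle>))"
proof -
  have "inj (\<lambda>k. \<langle>k, s k\<rangle>)" by (auto intro: injI)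
  then show ?thesis using finite_imageD infinite_UNIV_nat by blast
qed

lemma Pi2_infinite:
  assumes "Sigma0 (Suc (Suc 0)) (\<lambda>z. \<not> E z)"
  obtains act where "decidable act" "\<And>z. E z \<longleftrightarrow> infinite {t. act \<langle>z, t\<rangle>}"
proof -
  obtain Q where Q: "ce (\<lambda>z. \<not> Q z)" "\<And>z. \<not> E z \<longleftrightarrow> (\<exists>u. Q \<langle>z, u\<rangle>)"
    using assms by (rule Sigma0_SucE) blast
  from Q(1) obtain D where D: "Sigma0 0 (\<lambda>z. \<not> D z)" "\<And>y. \<not> Q y \<longleftrightarrow> (\<exists>v. D \<langle>y, v\<rangle>)"
    by (rule Sigma0_SucE) blast
  have dD: "decidable D" using decidable_not[of "\<lambda>z. \<not> D z"] D(1) by simp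
  have E: "E z \<longleftrightarrow> (\<forall>u. \<exists>v. D \<langle>\<langle>z, u\<rangle>, v\<rangle>)" for z using Q(2)[of z] D(2) by metis
  define S where "S z u c \<longleftrightarrow> (\<forall>u'\<le>u. \<exists>v\<le>c. D \<langle>\<langle>z, u'\<rangle>, v\<rangle>)" for z u c
  \<comment> \<open>\<open>c\<close> is the least common bound of witnesses for all \<open>u' \<le> u\<close>, so every \<open>u\<close> contributes at most one \<open>t\<close>\<close>
  define act where "act y \<longleftrightarrow> S (pfst y) (pfst (psnd y)) (psnd (psnd y)) \<and>
    (\<forall>c<psnd (psnd y). \<not> S (pfst y) (pfst (psnd y)) c)" for y
  have "decidable act" unfolding act_def S_def by (intro comp decidable_subst[OF dD])
  moreover have "E z \<longleftrightarrow> infinite {t. act \<langle>z, t\<rangle>}" for z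
  proof
    assume "E z"
    then obtain v where v: "\<And>u. D \<langle>\<langle>z, u\<rangle>, v u\<rangle>" unfolding E by metis
    have "S z u (\<Sum>u'\<le>u. v u')" for u
      unfolding S_def using v by (auto intro!: exI[of _ "v _"] member_le_sum)
    then have "S z u (LEAST c. S z u c)" for u by (rule LeastI)
    then have "act \<langle>z, \<langle>u, LEAST c. S z u c\<rangle>\<rangle>" for u
      unfolding act_def by (auto dest: not_less_Least)
    then have "range (\<lambda>u. \<langle>u, LEAST c. S z u c\<rangle>) \<subseteq> {t. act \<langle>z, t\<rangle>}" by auto
    moreover have "infinite (range (\<lambda>u. \<langle>u, LEAST c. S z u c\<rangle>))"
      by (rule infinite_range_pair)
    ultimately show "infinite {t. act \<langle>z, t\<rangle>}" by (rule infinite_super)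
  next
    assume inf: "infinite {t. act \<langle>z, t\<rangle>}"
    show "E z"
    proof (rule ccontr)
      assume "\<not> E z"
      then obtain u0 where u0: "\<And>v. \<not> D \<langle>\<langle>z, u0\<rangle>, v\<rangle>" unfolding E by blast
      have "t \<in> (\<lambda>u. \<langle>u, LEAST c. S z u c\<rangle>) ` {..<u0}" if "act \<langle>z, t\<rangle>" for t
      proof -
        obtain u c where t: "t = \<langle>u, c\<rangle>" by (rule pair_cases)
        have 1: "S z u c" "\<And>c'. c' < c \<Longrightarrow> \<not> S z u c'" using that unfolding t act_def by auto
        have "(LEAST c. S z u c) = c" by (rule Least_equality) (use 1 in \<open>auto simp: not_less[symmetric]\<close>)
        moreover have "u < u0" using 1(1) u0 unfolding S_def by (metis not_less)
        ultimately show ?thesis unfolding t by auto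
      qed
      then have "finite {t. act \<langle>z, t\<rangle>}"
        by (intro finite_subset[of "{t. act \<langle>z, t\<rangle>}" "(\<lambda>u. \<langle>u, LEAST c. S z u c\<rangle>) ` {..<u0}"]) auto
      with inf show False by contradiction
    qed
  qed
  ultimately show thesis by (rule that)
qed

text \<open>If \<open>j\<close> acts at infinitely many stages, then the columns
  \<open>k \<ge> j\<close> of the complement are empty and the finitely many others have at most one
  point each. If no \<open>j\<close> does, every column has a point.\<close>

lemma Sigma3_cofinite:
  assumes "Sigma0 (Suc (Suc (Suc 0))) R"
  obtains V where "ce V" "\<And>z. R z \<longleftrightarrow> finite {n. \<not> V \<langle>z, n\<rangle>}"
proof -
  obtain Q where Q: "Sigma0 (Suc (Suc 0)) (\<lambda>z. \<not> Q z)" "\<And>z. R z \<longleftrightarrow> (\<exists>j. Q \<langle>z, j\<rangle>)"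
    using assms by (rule Sigma0_SucE) blast
  from Q(1) obtain act where act: "decidable act" "\<And>y. Q y \<longleftrightarrow> infinite {t. act \<langle>y, t\<rangle>}"
    by (rule Pi2_infinite) blast
  define A where "A z k t \<longleftrightarrow> (\<exists>j\<le>k. act \<langle>\<langle>z, j\<rangle>, t\<rangle>)" for z k t
  \<comment> \<open>\<open>\<langle>k, s\<rangle>\<close> stays outside of \<open>V\<close> iff \<open>s\<close> is the last stage at which some \<open>j \<le> k\<close> acts\<close>
  define V where "V y \<longleftrightarrow> \<not> (psnd (psnd y) = 0 \<or> A (pfst y) (pfst (psnd y)) (psnd (psnd y))) \<or>
    (\<exists>t. psnd (psnd y) < t \<and> A (pfst y) (pfst (psnd y)) t)" for y
  have "ce V"
    unfolding V_def A_def
    by (intro arith Sigma0_decidable[OF decidable_not] Sigma0_decidable[OF decidable_bex_le]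
        comp decidable_subst[OF act(1)])
  moreover have "R z \<longleftrightarrow> finite {n. \<not> V \<langle>z, n\<rangle>}" for z
  proof
    assume "R z"
    then obtain j where j: "infinite {t. act \<langle>\<langle>z, j\<rangle>, t\<rangle>}" unfolding Q(2) act(2) by blast
    have "n \<in> (\<lambda>k. \<langle>k, THE s. \<not> V \<langle>z, \<langle>k, s\<rangle>\<rangle>\<rangle>) ` {..<j}" if n: "\<not> V \<langle>z, n\<rangle>" for n
    proof -
      obtain k s where ks: "n = \<langle>k, s\<rangle>" by (rule pair_cases)
      have "k < j"
      proof (rule ccontr)
        assume "\<not> k < j"
        then have "{t. act \<langle>\<langle>z, j\<rangle>, t\<rangle>} \<subseteq> {..s}" using n unfolding ks V_def A_def by force
        with j show False by (meson finite_atMost finite_subset)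
      qed
      moreover have "(THE s. \<not> V \<langle>z, \<langle>k, s\<rangle>\<rangle>) = s"
      proof (rule the_equality)
        show "s' = s" if "\<not> V \<langle>z, \<langle>k, s'\<rangle>\<rangle>" for s'
          using that n unfolding ks V_def by (simp add: not_le) (metis linorder_neqE_nat not_less0)
      qed (use n ks in simp)
      ultimately show ?thesis unfolding ks by auto
    qed
    then have "{n. \<not> V \<langle>z, n\<rangle>} \<subseteq> (\<lambda>k. \<langle>k, THE s. \<not> V \<langle>z, \<langle>k, s\<rangle>\<rangle>\<rangle>) ` {..<j}" by blast
    then show "finite {n. \<not> V \<langle>z, n\<rangle>}" by (rule finite_subset) simp
  next
    assume fin: "finite {n. \<not> V \<langle>z, n\<rangle>}"
    show "R z"
    proof (rule ccontr)
      assume "\<not> R z"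
      then have "finite {t. act \<langle>\<langle>z, j\<rangle>, t\<rangle>}" for j using Q(2) act(2) by blast
      then have "finite (\<Union>j\<in>{..k}. {t. act \<langle>\<langle>z, j\<rangle>, t\<rangle>})" for k by blast
      moreover have "{t. A z k t} = (\<Union>j\<in>{..k}. {t. act \<langle>\<langle>z, j\<rangle>, t\<rangle>})" for k
        unfolding A_def by auto
      ultimately have finA: "finite {t. A z k t}" for k by metis
      \<comment> \<open>The value 0 stands in when no \<open>j \<le> k\<close> ever acts; stage 0
        counts as an action in \<open>V\<close>.\<close>
      let ?s = "\<lambda>k. Max (insert 0 {t. A z k t})"
      have "\<not> V \<langle>z, \<langle>k, ?s k\<rangle>\<rangle>" for k
      proof -
        have "?s k \<in> insert 0 {t. A z k t}" using finA[of k] by (intro Max_in) auto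
        moreover have "t \<le> ?s k" if "A z k t" for t using that finA[of k] by (intro Max_ge) auto
        ultimately show ?thesis unfolding V_def by (auto simp: not_less)
      qed
      then have "range (\<lambda>k. \<langle>k, ?s k\<rangle>) \<subseteq> {n. \<not> V \<langle>z, n\<rangle>}" by blast
      moreover have "infinite (range (\<lambda>k. \<langle>k, ?s k\<rangle>))"
        by (rule infinite_range_pair)
      ultimately show False using fin finite_subset by blast
    qed
  qed
  ultimately show thesis by (rule that)
qed

text \<open>
  The number \<open>w\<close> codes a list whose \<open>k\<close>-th entry \<open>\<langle>a, u\<rangle>\<close> is the unique witness for the failure of the
  \<open>\<Pi>\<^sup>0\<^sub>4\<close> part of \<open>P\<close> at \<open>k\<close>: \<open>a\<close> is the least counterexample and \<open>u\<close> is the least bound of the numbers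
  that show that no \<open>a' < a\<close> is one.
\<close>

lemma Sigma5_normal_form:
  assumes "Sigma0 (Suc (Suc (Suc (Suc (Suc 0))))) P"
  obtains V where "ce V"
    "\<And>e. P e \<Longrightarrow> finite {w. infinite {n. \<not> V \<langle>\<langle>e, w\<rangle>, n\<rangle>}}"
    "\<And>e m. \<not> P e \<Longrightarrow> \<exists>w. code_length w = m \<and> infinite {n. \<not> V \<langle>\<langle>e, w\<rangle>, n\<rangle>}"
proof -
  obtain Q1 where Q1: "Sigma0 (Suc (Suc (Suc (Suc 0)))) (\<lambda>z. \<not> Q1 z)" "\<And>e. P e \<longleftrightarrow> (\<exists>k. Q1 \<langle>e, k\<rangle>)"
    using assms by (rule Sigma0_SucE) blast
  from Q1(1) obtain Q2 where
    Q2: "Sigma0 (Suc (Suc (Suc 0))) (\<lambda>z. \<not> Q2 z)" "\<And>z. \<not> Q1 z \<longleftrightarrow> (\<exists>a. Q2 \<langle>z, a\<rangle>)"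
    by (rule Sigma0_SucE) blast
  from Q2(1) obtain N where
    N: "Sigma0 (Suc (Suc 0)) (\<lambda>z. \<not> N z)" "\<And>z. \<not> Q2 z \<longleftrightarrow> (\<exists>b. N \<langle>z, b\<rangle>)"
    by (rule Sigma0_SucE) blast
  have P: "P e \<longleftrightarrow> (\<exists>k. \<forall>a. \<exists>b. N \<langle>\<langle>\<langle>e, k\<rangle>, a\<rangle>, b\<rangle>)" for e
    unfolding Q1(2) using Q2(2) N(2) by metis
  \<comment> \<open>For \<open>v = \<langle>a, u\<rangle>\<close> the disjuncts say in turn:
    \<open>a\<close> is no counterexample; some smaller number has no witness below
    \<open>u\<close>; a bound smaller than \<open>u\<close> suffices.\<close>
  define nG where "nG e k v \<longleftrightarrow> (\<exists>b. N \<langle>\<langle>\<langle>e, k\<rangle>, pfst v\<rangle>, b\<rangle>) \<or>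
    (\<exists>a<pfst v. \<forall>b<psnd v. \<not> N \<langle>\<langle>\<langle>e, k\<rangle>, a\<rangle>, b\<rangle>) \<or>
    (\<exists>u<psnd v. \<forall>a<pfst v. \<exists>b<u. N \<langle>\<langle>\<langle>e, k\<rangle>, a\<rangle>, b\<rangle>)" for e k v
  define R where "R z \<longleftrightarrow> (\<exists>k<code_length (psnd z). nG (pfst z) k (code_nth (psnd z) k))" for z
  have "Sigma0 (Suc (Suc (Suc 0))) R"
    unfolding R_def nG_def
    by (intro arith comp Sigma0_subst[OF Sigma0_Suc_if_Pi0[OF N(1)]]
        Sigma0_subst[OF Sigma0_Suc_if_Sigma0[OF N(1)]])
  then obtain V where V: "ce V" "\<And>z. R z \<longleftrightarrow> finite {n. \<not> V \<langle>z, n\<rangle>}"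
    by (rule Sigma3_cofinite) blast
  have unique: "v = v'" if "\<not> nG e k v" "\<not> nG e k v'" for e k v v'
  proof -
    obtain a u a' u' where v: "v = \<langle>a, u\<rangle>" "v' = \<langle>a', u'\<rangle>" by (metis pair_cases)
    have "a = a'" using that unfolding v nG_def by simp (metis linorder_neqE_nat)
    moreover have "u = u'" using that unfolding v nG_def \<open>a = a'\<close> by simp (metis linorder_neqE_nat)
    ultimately show ?thesis by (simp add: v)
  qed
  have exists: "\<exists>v. \<not> nG e k v" if "\<not> (\<forall>a. \<exists>b. N \<langle>\<langle>\<langle>e, k\<rangle>, a\<rangle>, b\<rangle>)" for e k
  proof -
    obtain a where a: "\<not> (\<exists>b. N \<langle>\<langle>\<langle>e, k\<rangle>, a\<rangle>, b\<rangle>)" "\<forall>a'<a. \<exists>b. N \<langle>\<langle>\<langle>e, k\<rangle>, a'\<rangle>, b\<rangle>"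
      using \<open>\<not> (\<forall>a. \<exists>b. N \<langle>\<langle>\<langle>e, k\<rangle>, a\<rangle>, b\<rangle>)\<close> exists_least_iff[of "\<lambda>a. \<not> (\<exists>b. N \<langle>\<langle>\<langle>e, k\<rangle>, a\<rangle>, b\<rangle>)"] by auto
    then obtain b where b: "\<And>a'. a' < a \<Longrightarrow> N \<langle>\<langle>\<langle>e, k\<rangle>, a'\<rangle>, b a'\<rangle>" by metis
    let ?T = "\<lambda>u. \<forall>a'<a. \<exists>b<u. N \<langle>\<langle>\<langle>e, k\<rangle>, a'\<rangle>, b\<rangle>"
    have "?T (Suc (\<Sum>a'<a. b a'))"
      using b by (auto intro!: exI[of _ "b _"] le_imp_less_Suc member_le_sum)
    then have "?T (LEAST u. ?T u)" by (rule LeastI)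
    then have "\<not> nG e k \<langle>a, LEAST u. ?T u\<rangle>"
      using a(1) not_less_Least[of _ ?T] unfolding nG_def by auto
    then show ?thesis by blast
  qed
  show thesis
  proof (rule that[OF V(1)])
    fix e assume "P e"
    then obtain k0 where k0: "\<And>a. \<exists>b. N \<langle>\<langle>\<langle>e, k0\<rangle>, a\<rangle>, b\<rangle>" unfolding P by blast
    \<comment> \<open>Uniqueness leaves at most one correct list of each length, and a list longer
      than \<open>k0\<close> would have to witness a failure at \<open>k0\<close>.\<close>
    have "inj_on code_length {w. \<not> R \<langle>e, w\<rangle>}"
    proof (rule inj_onI)
      fix w w' assume w: "w \<in> {w. \<not> R \<langle>e, w\<rangle>}" "w' \<in> {w. \<not> R \<langle>e, w\<rangle>}" "code_length w = code_length w'"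
      have "list_decode w = list_decode w'"
      proof (rule nth_equalityI)
        show "length (list_decode w) = length (list_decode w')"
          using w(3) by (simp add: code_length_def)
        fix k assume "k < length (list_decode w)"
        then have k: "k < code_length w" "k < code_length w'" using w(3) by (simp_all add: code_length_def)
        have "\<not> nG e k (code_nth w k)" "\<not> nG e k (code_nth w' k)"
          using w(1,2) k unfolding R_def by auto
        from unique[OF this] k show "list_decode w ! k = list_decode w' ! k" by (simp add: code_nth)
      qed
      then show "w = w'" by (simp add: list_decode_eq)
    qed
    moreover have "code_length ` {w. \<not> R \<langle>e, w\<rangle>} \<subseteq> {..k0}"
    proof
      fix m assume "m \<in> code_length ` {w. \<not> R \<langle>e, w\<rangle>}"
      then obtain w where w: "m = code_length w" "\<not> R \<langle>e, w\<rangle>" by blast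
      have "\<not> k0 < m" using w(2) k0 unfolding w(1) R_def nG_def by fastforce
      then show "m \<in> {..k0}" by simp
    qed
    ultimately have "finite {w. \<not> R \<langle>e, w\<rangle>}" by (rule inj_on_finite) simp
    then show "finite {w. infinite {n. \<not> V \<langle>\<langle>e, w\<rangle>, n\<rangle>}}" using V(2) by simp
  next
    fix e m assume "\<not> P e"
    then obtain v where v: "\<And>k. \<not> nG e k (v k)" using exists unfolding P by metis
    obtain w where w: "code_length w = m" "\<forall>k<m. code_nth w k = v k" using ex_code_nth by blast
    then have "\<not> R \<langle>e, w\<rangle>" using v unfolding R_def by simp
    with w(1) V(2) show "\<exists>w. code_length w = m \<and> infinite {n. \<not> V \<langle>\<langle>e, w\<rangle>, n\<rangle>}" by blast
  qed
qed

subsection \<open>Enumerations and locking sequences\<close>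

lemma initial_segment_simps [simp]:
  "length (initial_segment f i) = i" "set (initial_segment f i) = f ` {..<i}"
  by (auto simp: initial_segment_def)

lemma set_initial_segment_subset: "set (initial_segment f i) \<subseteq> content f"
  by (auto simp: content_def)

lemma finite_subset_initial_segment:
  assumes "finite F" "F \<subseteq> content f"
  obtains n where "\<And>i. i > n \<Longrightarrow> F \<subseteq> set (initial_segment f i)"
proof -
  have "F \<subseteq> range f" using assms(2) by (auto simp: content_def)
  then obtain C where C: "finite C" "F = f ` C" using assms(1) finite_subset_image by metis
  show thesis
  proof (rule that[of "\<Sum>C"])
    fix i assume i: "\<Sum>C < i"
    have "x < i" if "x \<in> C" for x
      using member_le_sum[OF that, of "\<lambda>x. x"] C(1) i by simp
    then show "F \<subseteq> set (initial_segment f i)" using C(2) by auto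
  qed
qed

lemma ex_enumeration_extending:
  assumes "S \<noteq> {}" "set \<sigma> \<subseteq> S"
  obtains f where "content f = S"
    "\<And>i. initial_segment f (length \<sigma> + i) = \<sigma> @ map (\<lambda>k. f (length \<sigma> + k)) [0..<i]"
proof -
  obtain a where a: "a \<in> S" using assms(1) by blast
  let ?g = "\<lambda>n. if n \<in> S then n else a"
  let ?f = "\<lambda>n. if n < length \<sigma> then \<sigma> ! n else ?g (n - length \<sigma>)"
  show thesis
  proof (rule that[of ?f])
    have "?f n \<in> S" for n using assms(2) a nth_mem by auto
    moreover have "\<exists>n. ?f n = s" if "s \<in> S" for s using that by (intro exI[of _ "length \<sigma> + s"]) simp
    ultimately show "content ?f = S" unfolding content_def by blast
    show "initial_segment ?f (length \<sigma> + i) = \<sigma> @ map (\<lambda>k. ?f (length \<sigma> + k)) [0..<i]" for i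
      by (rule nth_equalityI) (auto simp: initial_segment_def nth_append)
  qed
qed

text \<open>
  If no locking sequence existed, then every finite sequence in \<open>S\<close> could be extended to one with a
  wrong hypothesis; alternating such extensions with the members of \<open>S\<close> gives an enumeration that is
  not identified.
\<close>

lemma ex_locking_sequence:
  assumes "TxtBC_learns_set M S" "S \<noteq> {}"
  obtains \<sigma> where "set \<sigma> \<subseteq> S" "\<And>\<rho>. set \<rho> \<subseteq> S \<Longrightarrow> \<exists>e. M (\<sigma> @ \<rho>) = Some e \<and> W e = S"
proof (rule ccontr)
  assume "\<not> thesis"
  then have "\<forall>\<sigma>. \<exists>\<rho>. set \<sigma> \<subseteq> S \<longrightarrow> set \<rho> \<subseteq> S \<and> \<not> (\<exists>e. M (\<sigma> @ \<rho>) = Some e \<and> W e = S)"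
    using that by blast
  then obtain ext where ext: "\<And>\<sigma>. set \<sigma> \<subseteq> S \<Longrightarrow>
      set (ext \<sigma>) \<subseteq> S \<and> \<not> (\<exists>e. M (\<sigma> @ ext \<sigma>) = Some e \<and> W e = S)" by metis
  obtain a where a: "a \<in> S" using assms(2) by blast
  let ?g = "\<lambda>n. if n \<in> S then n else a"
  define s where "s n = rec_nat [] (\<lambda>n \<sigma>. \<sigma> @ ext \<sigma> @ [?g n]) n" for n
  have s_Suc: "s (Suc n) = s n @ ext (s n) @ [?g n]" for n by (simp add: s_def)
  have s_sub: "set (s n) \<subseteq> S" for n
  proof (induction n)
    case 0 show ?case by (simp add: s_def)
  next
    case (Suc n) then show ?case using ext[OF Suc] a by (auto simp: s_Suc)
  qed
  have s_len: "n \<le> length (s n)" for n by (induction n) (auto simp: s_Suc)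
  have prefix: "\<exists>\<rho>. s (n + m) = s n @ \<rho>" for n m by (induction m) (auto simp: s_Suc)
  \<comment> \<open>The limit of the chain \<open>s\<close>; position \<open>k\<close> exists in
    \<open>s (Suc k)\<close> by \<open>s_len\<close>.\<close>
  define f where "f k = s (Suc k) ! k" for k
  have f: "f k = s n ! k" if "k < length (s n)" for k n
  proof -
    have k: "k < length (s (Suc k))" using s_len[of "Suc k"] by simp
    consider (1) d where "n = Suc k + d" | (2) d where "Suc k = n + d"
      by (metis le_add_diff_inverse nat_le_linear)
    then show ?thesis
    proof cases
      case 1 then show ?thesis using prefix[of "Suc k" d] k by (auto simp: f_def nth_append)
    next
      case 2 then show ?thesis using prefix[of n d] that by (auto simp: f_def nth_append)
    qed
  qed
  have seg: "initial_segment f (length (s n @ ext (s n))) = s n @ ext (s n)" for n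
  proof (rule nth_equalityI)
    fix k assume "k < length (initial_segment f (length (s n @ ext (s n))))"
    then have k: "k < length (s n @ ext (s n))" by simp
    then have "f k = s (Suc n) ! k" by (intro f) (simp add: s_Suc)
    also have "\<dots> = (s n @ ext (s n)) ! k" using k by (simp only: s_Suc nth_append[of "s n @ ext (s n)"] append_assoc[symmetric] if_True)
    finally show "initial_segment f (length (s n @ ext (s n))) ! k = (s n @ ext (s n)) ! k"
      using k by (simp add: initial_segment_def)
  qed simp
  have "f k \<in> S" for k
    using s_sub[of "Suc k"] s_len[of "Suc k"] unfolding f_def by (metis Suc_le_eq nth_mem subsetD)
  moreover have "\<exists>k. f k = y" if "y \<in> S" for y
  proof -
    have "y \<in> set (s (Suc y))" using that by (simp add: s_Suc)
    then show ?thesis using f by (metis in_set_conv_nth)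
  qed
  ultimately have content: "content f = S" unfolding content_def by blast
  then obtain n where "\<And>i. i > n \<Longrightarrow> \<exists>e. M (initial_segment f i) = Some e \<and> W e = S"
    using assms(1) unfolding TxtBC_learns_set_def TxtBC_identifies_def enumeration_of_def by blast
  \<comment> \<open>The index \<open>Suc n\<close> makes this segment longer than
    \<open>n\<close>.\<close>
  from this[of "length (s (Suc n) @ ext (s (Suc n)))"] show False
    using ext[OF s_sub, of "Suc n"] s_len[of "Suc n"] unfolding seg by simp
qed

subsection \<open>The family that defeats one learning machine\<close>

definition acts :: "(nat \<Rightarrow> nat \<Rightarrow> bool) \<Rightarrow> nat \<Rightarrow> nat \<Rightarrow> bool" where
  "acts act k n \<longleftrightarrow> (\<exists>t. n \<le> t \<and> (\<exists>j<k. act j t))"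

text \<open>
  All languages of the family number \<open>w\<close> consist of elements \<open>\<langle>w, \<langle>k, n\<rangle>\<rangle>\<close>; those with \<open>k = 0\<close> are the
  plain numbers \<open>n\<close>, the others are tags. Language \<open>0\<close> has all numbers and those tags \<open>\<langle>k, n\<rangle>\<close> that are
  outdated because some \<open>j < k\<close> acts at a stage \<open>t \<ge> n\<close>. Language \<open>c = Suc i\<close> lacks numbers unless \<open>V\<close>
  supplies them or some \<open>j < i\<close> acts forever, and it has a tag outside of language \<open>0\<close> unless some \<open>j < c\<close>
  acts forever.
\<close>

definition member :: "(nat \<Rightarrow> nat \<Rightarrow> bool) \<Rightarrow> (nat \<Rightarrow> bool) \<Rightarrow> nat \<Rightarrow> nat \<Rightarrow> nat \<Rightarrow> bool" where
  "member act V w c y \<longleftrightarrow> pfst y = w \<and>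
    (0 < pfst (psnd y) \<and> acts act (pfst (psnd y)) (psnd (psnd y)) \<or>
     pfst (psnd y) = 0 \<and> (c = 0 \<or> psnd (psnd y) < c \<or> V (psnd (psnd y)) \<or> acts act (c - 1) (psnd (psnd y))) \<or>
     0 < c \<and> pfst (psnd y) = c \<and> (psnd (psnd y) = 0 \<or> (\<exists>j<c. act j (psnd (psnd y) - 1))))"

lemma member_pair:
  "member act V w c \<langle>w', \<langle>k, n\<rangle>\<rangle> \<longleftrightarrow> w' = w \<and>
    (0 < k \<and> acts act k n \<or>
     k = 0 \<and> (c = 0 \<or> n < c \<or> V n \<or> acts act (c - 1) n) \<or>
     0 < c \<and> k = c \<and> (n = 0 \<or> (\<exists>j<c. act j (n - 1))))"
  by (simp add: member_def)

text \<open>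
  On enumerations of a language that differs only finitely from the elements common to all of them, the
  data seen so far eventually supply the difference. The last disjunct serves language \<open>0\<close> when \<open>V\<close> is
  coinfinite; the parameter \<open>q = 0\<close> switches it off.
\<close>

definition hypothesis ::
    "(nat \<Rightarrow> nat \<Rightarrow> bool) \<Rightarrow> (nat \<Rightarrow> bool) \<Rightarrow> nat \<Rightarrow> nat \<Rightarrow> nat list \<Rightarrow> nat \<Rightarrow> bool" where
  "hypothesis act V w q \<tau> y \<longleftrightarrow> y \<in> set \<tau> \<or> pfst y = w \<and>
    (0 < pfst (psnd y) \<and> acts act (pfst (psnd y)) (psnd (psnd y)) \<or>
     pfst (psnd y) = 0 \<and> (V (psnd (psnd y)) \<or>
       0 < q \<and> \<langle>w, \<langle>0, q - 1\<rangle>\<rangle> \<in> set \<tau> \<and> (\<forall>x\<in>set \<tau>. member act V w 0 x)))"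

lemma hypothesis_pair:
  "hypothesis act V w q \<tau> \<langle>w', \<langle>k, n\<rangle>\<rangle> \<longleftrightarrow> \<langle>w', \<langle>k, n\<rangle>\<rangle> \<in> set \<tau> \<or> w' = w \<and>
    (0 < k \<and> acts act k n \<or>
     k = 0 \<and> (V n \<or> 0 < q \<and> \<langle>w, \<langle>0, q - 1\<rangle>\<rangle> \<in> set \<tau> \<and> (\<forall>x\<in>set \<tau>. member act V w 0 x)))"
  by (simp add: hypothesis_def)

section \<open>Consequences of acting finitely or infinitely often\<close>

lemma acts_if_infinite: "infinite {t. act j t} \<Longrightarrow> j < k \<Longrightarrow> acts act k n"
  unfolding acts_def infinite_nat_iff_unbounded_le by blast

lemma finite_acts:
  fixes act :: "nat \<Rightarrow> nat \<Rightarrow> bool"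
  assumes "\<And>j. j < k \<Longrightarrow> finite {t. act j t}"
  shows "finite {t. \<exists>j<k. act j t}"
proof -
  have "finite (\<Union>j\<in>{..<k}. {t. act j t})" using assms by (intro finite_UN_I) auto
  moreover have "{t. \<exists>j<k. act j t} = (\<Union>j\<in>{..<k}. {t. act j t})" by auto
  ultimately show ?thesis by simp
qed

lemma acts_bounded:
  assumes "\<And>j. j < k \<Longrightarrow> finite {t. act j t}"
  obtains b where "\<And>n. acts act k n \<Longrightarrow> n \<le> b"
  using finite_acts[of k act, OF assms] unfolding finite_nat_set_iff_bounded_le acts_def
  by (metis (mono_tags, lifting) mem_Collect_eq order_trans)

text \<open>A language starts with tag 0 and receives tag \<open>Suc t\<close> upon an action at
  stage \<open>t\<close>. The tag due to the last action is never outdated.\<close>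

lemma ex_current_tag:
  assumes "\<And>j. j < k \<Longrightarrow> finite {t. act j t}"
  obtains n where "n = 0 \<or> (\<exists>j<k. act j (n - 1))" "\<not> acts act k n"
proof (cases "{t. \<exists>j<k. act j t} = {}")
  case True
  then show thesis by (intro that[of 0]) (auto simp: acts_def)
next
  case False
  note fin = finite_acts[of k act, OF assms]
  let ?n = "Suc (Max {t. \<exists>j<k. act j t})"
  have "Max {t. \<exists>j<k. act j t} \<in> {t. \<exists>j<k. act j t}" using fin False by (rule Max_in)
  moreover have "\<not> acts act k ?n" using Max_ge[OF fin] unfolding acts_def by force
  ultimately show thesis by (intro that[of ?n]) auto
qed

text \<open>Beyond \<open>i\<close> and the last action of any \<open>j < i\<close>, only
  \<open>V\<close> puts numbers into language \<open>Suc i\<close>.\<close>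

lemma ex_missing_number:
  assumes "infinite {n. \<not> V n}" "\<And>j. j < i \<Longrightarrow> finite {t. act j t}"
  obtains n where "\<not> member act V w (Suc i) \<langle>w, \<langle>0, n\<rangle>\<rangle>"
proof -
  obtain b where b: "\<And>n. acts act i n \<Longrightarrow> n \<le> b" using acts_bounded assms(2) by blast
  obtain n where "n > max i b" "\<not> V n" using assms(1) unfolding infinite_nat_iff_unbounded by blast
  with b have "\<not> member act V w (Suc i) \<langle>w, \<langle>0, n\<rangle>\<rangle>"
    using not_le by (auto simp: member_pair less_Suc_eq_le)
  then show thesis by (rule that)
qed

text \<open>\<open>hypothesis act V w 0 []\<close> is the part common to all languages. The
  assumption bounds the additional numbers. The additional tags are finite in number, or, if some
  \<open>j < c\<close> acts forever, all outdated and therefore common.\<close>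

lemma finite_member_diff:
  assumes "finite {n. \<not> V n} \<or> 0 < c \<and> (\<forall>j<c - 1. finite {t. act j t})"
  shows "finite {y. member act V w c y \<and> \<not> hypothesis act V w 0 [] y}"
proof -
  have "finite {n. (c = 0 \<or> n < c \<or> acts act (c - 1) n) \<and> \<not> V n}" (is "finite ?F0")
    using assms
  proof
    assume "0 < c \<and> (\<forall>j<c - 1. finite {t. act j t})"
    then obtain b where "\<And>n. acts act (c - 1) n \<Longrightarrow> n \<le> b" "0 < c"
      using acts_bounded[of "c - 1" act] by blast
    then have "?F0 \<subseteq> {..max b c}" by fastforce
    then show ?thesis by (rule finite_subset) simp
  qed (auto elim: rev_finite_subset)
  moreover have "finite {n. (n = 0 \<or> (\<exists>j<c. act j (n - 1))) \<and> \<not> acts act c n}" (is "finite ?F1")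
  proof (cases "\<forall>j<c. finite {t. act j t}")
    case True
    then have "finite {t. \<exists>j<c. act j t}" using finite_acts[of c act] by blast
    then have "finite (insert 0 (Suc ` {t. \<exists>j<c. act j t}))" by blast
    moreover have "?F1 \<subseteq> insert 0 (Suc ` {t. \<exists>j<c. act j t})"
    proof
      fix n assume "n \<in> ?F1" then show "n \<in> insert 0 (Suc ` {t. \<exists>j<c. act j t})" by (cases n) auto
    qed
    ultimately show ?thesis by (rule finite_subset[rotated])
  next
    case False
    then have "acts act c n" for n using acts_if_infinite by blast
    then have "?F1 = {}" by simp
    then show ?thesis by (simp only: finite.emptyI)
  qed
  ultimately have "finite ((\<lambda>n. \<langle>w, \<langle>0, n\<rangle>\<rangle>) ` ?F0 \<union> (\<lambda>n. \<langle>w, \<langle>c, n\<rangle>\<rangle>) ` ?F1)" by blast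
  moreover have "{y. member act V w c y \<and> \<not> hypothesis act V w 0 [] y} \<subseteq>
    (\<lambda>n. \<langle>w, \<langle>0, n\<rangle>\<rangle>) ` ?F0 \<union> (\<lambda>n. \<langle>w, \<langle>c, n\<rangle>\<rangle>) ` ?F1"
  proof
    fix y assume y: "y \<in> {y. member act V w c y \<and> \<not> hypothesis act V w 0 [] y}"
    obtain w' k n where "y = \<langle>w', \<langle>k, n\<rangle>\<rangle>" by (metis pair_cases)
    with y show "y \<in> (\<lambda>n. \<langle>w, \<langle>0, n\<rangle>\<rangle>) ` ?F0 \<union> (\<lambda>n. \<langle>w, \<langle>c, n\<rangle>\<rangle>) ` ?F1"
      by (auto simp: member_pair hypothesis_pair)
  qed
  ultimately show ?thesis by (rule finite_subset[rotated])
qed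

text \<open>Assumption \<open>off\<close> lists the ways in which the last disjunct of
  \<open>hypothesis\<close> fails in the limit: it is switched off, its trigger number never
  appears, or a datum outside language \<open>0\<close> does. That datum joins the finite difference
  that must have been seen.\<close>

lemma hypothesis_converges_off:
  assumes f: "content f = {y. member act V w c y}"
    and fin: "finite {n. \<not> V n} \<or> 0 < c \<and> (\<forall>j<c - 1. finite {t. act j t})"
    and off: "q = 0 \<or> \<not> member act V w c \<langle>w, \<langle>0, q - 1\<rangle>\<rangle> \<or> (\<exists>x\<in>content f. \<not> member act V w 0 x)"
  shows "\<exists>n. \<forall>i>n. {y. hypothesis act V w q (initial_segment f i) y} = {y. member act V w c y}"
proof -
  obtain F where F: "finite F" "F \<subseteq> content f"
    "q = 0 \<or> \<not> member act V w c \<langle>w, \<langle>0, q - 1\<rangle>\<rangle> \<or> (\<exists>x\<in>F. \<not> member act V w 0 x)"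
  proof (cases "\<exists>x\<in>content f. \<not> member act V w 0 x")
    case True then show thesis using that[of "{_}"] by auto
  next
    case False with off show thesis using that[of "{}"] by auto
  qed
  let ?G = "F \<union> {y. member act V w c y \<and> \<not> hypothesis act V w 0 [] y}"
  have "finite ?G" "?G \<subseteq> content f" using F finite_member_diff[OF fin] f by auto
  then obtain n where n: "\<And>i. i > n \<Longrightarrow> ?G \<subseteq> set (initial_segment f i)"
    by (rule finite_subset_initial_segment) blast
  have "hypothesis act V w q (initial_segment f i) y \<longleftrightarrow> member act V w c y" if "i > n" for i y
  proof -
    have G: "?G \<subseteq> set (initial_segment f i)" using n that .
    have sub: "\<And>x. x \<in> set (initial_segment f i) \<Longrightarrow> member act V w c x"
      using set_initial_segment_subset f by blast
    have "\<not> (0 < q \<and> \<langle>w, \<langle>0, q - 1\<rangle>\<rangle> \<in> set (initial_segment f i) \<and>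
        (\<forall>x\<in>set (initial_segment f i). member act V w 0 x))"
      using F(3) G sub by auto
    then have "hypothesis act V w q (initial_segment f i) y \<longleftrightarrow>
        y \<in> set (initial_segment f i) \<or> hypothesis act V w 0 [] y"
      unfolding hypothesis_def by auto
    moreover have "hypothesis act V w 0 [] y \<Longrightarrow> member act V w c y"
      unfolding hypothesis_def member_def by auto
    ultimately show ?thesis using G sub by blast
  qed
  then show ?thesis by blast
qed

lemma hypothesis_converges_cofinite:
  assumes "finite {n. \<not> V n}" "content f = {y. member act V w c y}"
  shows "\<exists>n. \<forall>i>n. {y. hypothesis act V w 0 (initial_segment f i) y} = {y. member act V w c y}"
  using hypothesis_converges_off[OF assms(2)] assms(1) by blast

text \<open>
  Only the first \<open>i\<close> acting forever, if there is one, needs \<open>q\<close>: language \<open>Suc i\<close> is a proper subset of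
  language \<open>0\<close>, the earlier ones are marked by a tag, and the later ones coincide with language \<open>0\<close>.
\<close>

lemma hypothesis_converges_coinfinite:
  assumes V: "infinite {n. \<not> V n}"
  shows "\<exists>q. \<forall>c f. content f = {y. member act V w c y} \<longrightarrow>
    (\<exists>n. \<forall>i>n. {y. hypothesis act V w (Suc q) (initial_segment f i) y} = {y. member act V w c y})"
proof -
  obtain q where q: "\<And>i. infinite {t. act i t} \<Longrightarrow> (\<And>j. j < i \<Longrightarrow> finite {t. act j t}) \<Longrightarrow>
      \<not> member act V w (Suc i) \<langle>w, \<langle>0, q\<rangle>\<rangle>"
  proof (cases "\<exists>i. infinite {t. act i t} \<and> (\<forall>j<i. finite {t. act j t})")
    case True
    then obtain i where i: "infinite {t. act i t}" "\<forall>j<i. finite {t. act j t}" by blast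
    obtain n where n: "\<not> member act V w (Suc i) \<langle>w, \<langle>0, n\<rangle>\<rangle>"
      using ex_missing_number[OF V, of i act w] i(2) by blast
    have "i' = i" if "infinite {t. act i' t}" "\<And>j. j < i' \<Longrightarrow> finite {t. act j t}" for i'
      using that i by (metis linorder_neqE_nat)
    with n show thesis using that[of n] by metis
  next
    case False then show thesis using that by blast
  qed
  have "\<exists>n. \<forall>i>n. {y. hypothesis act V w (Suc q) (initial_segment f i) y} = {y. member act V w c y}"
    if f: "content f = {y. member act V w c y}" for c f
  proof (cases "0 < c \<and> (\<forall>j<c - 1. finite {t. act j t})")
    case True
    have "\<not> member act V w c \<langle>w, \<langle>0, q\<rangle>\<rangle> \<or> (\<exists>x\<in>content f. \<not> member act V w 0 x)"
    proof (cases "finite {t. act (c - 1) t}")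
      case True
      with \<open>0 < c \<and> _\<close> have "finite {t. act j t}" if "j < c" for j
        using that by (cases "j = c - 1") auto
      then obtain n where "n = 0 \<or> (\<exists>j<c. act j (n - 1))" "\<not> acts act c n"
        using ex_current_tag[of c act] by blast
      then have "member act V w c \<langle>w, \<langle>c, n\<rangle>\<rangle>" "\<not> member act V w 0 \<langle>w, \<langle>c, n\<rangle>\<rangle>"
        using \<open>0 < c \<and> _\<close> by (auto simp: member_pair)
      with f show ?thesis by blast
    next
      case False
      then show ?thesis using q[of "c - 1"] \<open>0 < c \<and> _\<close> by simp
    qed
    then show ?thesis using hypothesis_converges_off[OF f, of "Suc q"] True by auto
  next
    case False
    have eq: "member act V w c y \<longleftrightarrow> member act V w 0 y" for y
    proof (cases "c = 0")
      case nz: False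
      with False obtain j where j: "j < c - 1" "infinite {t. act j t}" by blast
      then have "acts act (c - 1) n" "acts act c n" for n by (auto intro: acts_if_infinite)
      then show ?thesis using nz unfolding member_def by auto
    qed simp
    have "\<langle>w, \<langle>0, q\<rangle>\<rangle> \<in> content f" using f by (simp add: eq) (simp add: member_pair)
    then obtain n where n: "\<And>i. i > n \<Longrightarrow> {\<langle>w, \<langle>0, q\<rangle>\<rangle>} \<subseteq> set (initial_segment f i)"
      using finite_subset_initial_segment[of "{\<langle>w, \<langle>0, q\<rangle>\<rangle>}" f] by blast
    have "hypothesis act V w (Suc q) (initial_segment f i) y \<longleftrightarrow> member act V w c y" if "i > n" for i y
    proof -
      have sub: "\<And>x. x \<in> set (initial_segment f i) \<Longrightarrow> member act V w 0 x"
        using set_initial_segment_subset f eq by blast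
      have "\<langle>w, \<langle>0, q\<rangle>\<rangle> \<in> set (initial_segment f i)" using n[OF that] by blast
      with sub have "hypothesis act V w (Suc q) (initial_segment f i) y \<longleftrightarrow>
          y \<in> set (initial_segment f i) \<or> member act V w 0 y"
        unfolding hypothesis_def member_def by (simp del: initial_segment_simps)
      with sub show ?thesis unfolding eq by blast
    qed
    then show ?thesis by blast
  qed
  then show ?thesis by blast
qed

text \<open>
  The machine \<open>M\<close> fails on language \<open>0\<close> unless that has a locking sequence \<open>\<sigma>\<close>. In that case the \<open>i\<close>
  coding the first \<open>\<sigma>\<close> satisfying the condition on the right acts forever, and on extensions of \<open>\<sigma>\<close>
  within language \<open>Suc i\<close> all hypotheses of \<open>M\<close> contain a number missing from that language.
\<close>

lemma defeats_machine:
  assumes act: "\<And>j. infinite {t. act j t} \<longleftrightarrow> (\<forall>x\<in>set (list_decode j). member act V w 0 x) \<and>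
      (\<forall>\<rho>. (\<forall>x\<in>set \<rho>. member act V w 0 x) \<longrightarrow>
        (\<forall>n. \<exists>h. M (list_decode j @ \<rho>) = Some h \<and> \<langle>w, \<langle>0, n\<rangle>\<rangle> \<in> W h))"
    and V: "infinite {n. \<not> V n}"
  shows "\<exists>c. \<not> TxtBC_learns_set M {y. member act V w c y}"
proof (rule ccontr)
  assume "\<not> ?thesis"
  then have learns: "TxtBC_learns_set M {y. member act V w c y}" for c by blast
  have num: "\<langle>w, \<langle>0, n\<rangle>\<rangle> \<in> {y. member act V w 0 y}" for n by (simp add: member_pair)
  then have "{y. member act V w 0 y} \<noteq> {}" by blast
  then obtain \<sigma>' where \<sigma>': "set \<sigma>' \<subseteq> {y. member act V w 0 y}"
    "\<And>\<rho>. set \<rho> \<subseteq> {y. member act V w 0 y} \<Longrightarrow> \<exists>e. M (\<sigma>' @ \<rho>) = Some e \<and> W e = {y. member act V w 0 y}"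
    using ex_locking_sequence[OF learns] by blast
  have "infinite {t. act (list_encode \<sigma>') t}"
    unfolding act list_encode_inverse
  proof (intro conjI allI impI)
    fix \<rho> n assume "\<forall>x\<in>set \<rho>. member act V w 0 x"
    then obtain e where "M (\<sigma>' @ \<rho>) = Some e" "W e = {y. member act V w 0 y}" using \<sigma>'(2)[of \<rho>] by blast
    then show "\<exists>h. M (\<sigma>' @ \<rho>) = Some h \<and> \<langle>w, \<langle>0, n\<rangle>\<rangle> \<in> W h" using num by blast
  qed (use \<sigma>'(1) in blast)
  then obtain i where i: "infinite {t. act i t}" "\<And>j. j < i \<Longrightarrow> finite {t. act j t}"
    using exists_least_iff[of "\<lambda>i. infinite {t. act i t}"] by auto
  let ?L = "{y. member act V w (Suc i) y}" and ?\<sigma> = "list_decode i"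
  obtain n where n: "\<langle>w, \<langle>0, n\<rangle>\<rangle> \<notin> ?L" using ex_missing_number[OF V, of i act w] i(2) by blast
  \<comment> \<open>The own tags of language \<open>Suc i\<close> are all outdated, since
    \<open>i\<close> itself acts forever.\<close>
  have sub: "?L \<subseteq> {y. member act V w 0 y}"
    using acts_if_infinite[of act i "Suc i"] i(1) unfolding member_def by auto
  have "set ?\<sigma> \<subseteq> ?L"
  proof
    fix x assume x: "x \<in> set ?\<sigma>"
    \<comment> \<open>Members of a coded list are bounded by its code \<open>i\<close>, so the plain
      numbers in \<open>?\<sigma>\<close> belong to language \<open>Suc i\<close>; the tags in it
      are outdated ones.\<close>
    then have "psnd (psnd x) < Suc i"
      using mem_le_code[OF x] by (meson snd_prod_decode_le le_imp_less_Suc order_trans)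
    moreover have "member act V w 0 x" using act i(1) x by blast
    ultimately show "x \<in> ?L" unfolding member_def by auto
  qed
  moreover have "\<langle>w, \<langle>0, 0\<rangle>\<rangle> \<in> ?L" by (simp add: member_pair)
  ultimately obtain f where f: "content f = ?L"
    "\<And>m. initial_segment f (length ?\<sigma> + m) = ?\<sigma> @ map (\<lambda>k. f (length ?\<sigma> + k)) [0..<m]"
    using ex_enumeration_extending[of ?L ?\<sigma>] by blast
  then have "TxtBC_identifies M f"
    using learns[of "Suc i"] unfolding TxtBC_learns_set_def enumeration_of_def by simp
  then obtain n0 where n0: "\<And>m. m > n0 \<Longrightarrow> \<exists>e. M (initial_segment f m) = Some e \<and> W e = ?L"
    unfolding TxtBC_identifies_def f(1) by auto
  let ?\<rho> = "map (\<lambda>k. f (length ?\<sigma> + k)) [0..<Suc n0]"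
  have "\<exists>e. M (?\<sigma> @ ?\<rho>) = Some e \<and> W e = ?L"
    using n0[of "length ?\<sigma> + Suc n0"] unfolding f(2) by (simp only: less_add_Suc2 simp_thms)
  moreover have "\<forall>x\<in>set ?\<rho>. member act V w 0 x" using f(1) sub unfolding content_def by auto
  then have "\<exists>h. M (?\<sigma> @ ?\<rho>) = Some h \<and> \<langle>w, \<langle>0, n\<rangle>\<rangle> \<in> W h" using act i(1) by blast
  ultimately show False using n by auto
qed

subsection \<open>The reduction\<close>

text \<open>Turns quantification over extensions of a sequence into a decidable condition on
  codes.\<close>

lemma code_prefix_iff:
  "(\<exists>\<rho>. list_decode r = list_decode j @ \<rho>) \<longleftrightarrow>
    code_length j \<le> code_length r \<and> (\<forall>k<code_length j. code_nth r k = code_nth j k)"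
proof
  assume "\<exists>\<rho>. list_decode r = list_decode j @ \<rho>"
  then obtain \<rho> where r: "list_decode r = list_decode j @ \<rho>" by blast
  then have le: "code_length j \<le> code_length r" by (simp add: code_length_def)
  moreover have "code_nth r k = code_nth j k" if "k < code_length j" for k
    using that le r by (simp add: code_nth) (simp add: code_length_def nth_append)
  ultimately show "code_length j \<le> code_length r \<and> (\<forall>k<code_length j. code_nth r k = code_nth j k)" by blast
next
  assume *: "code_length j \<le> code_length r \<and> (\<forall>k<code_length j. code_nth r k = code_nth j k)"
  have "take (code_length j) (list_decode r) = list_decode j"
  proof (rule nth_equalityI)
    show "length (take (code_length j) (list_decode r)) = length (list_decode j)"
      using * by (simp add: code_length_def)
    fix k assume "k < length (take (code_length j) (list_decode r))"
    then have "k < code_length j" "k < code_length r" using * by (simp_all add: code_length_def)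
    with * show "take (code_length j) (list_decode r) ! k = list_decode j ! k"
      by (simp add: code_nth[symmetric])
  qed
  then show "\<exists>\<rho>. list_decode r = list_decode j @ \<rho>" by (metis append_take_drop_id)
qed

text \<open>
  Machine \<open>code_length w\<close> is the one to be defeated by the family number \<open>w\<close>. The recursion theorem
  provides an index \<open>a z\<close> of its language \<open>0\<close>, to which the locking condition itself refers.
\<close>

lemma ex_acting:
  obtains act where "decidable act"
    "\<And>e w j V. infinite {t. act \<langle>\<langle>\<langle>e, w\<rangle>, j\<rangle>, t\<rangle>} \<longleftrightarrow>
      (\<forall>x\<in>set (list_decode j). member (\<lambda>j t. act \<langle>\<langle>\<langle>e, w\<rangle>, j\<rangle>, t\<rangle>) V w 0 x) \<and>
      (\<forall>\<rho>. (\<forall>x\<in>set \<rho>. member (\<lambda>j t. act \<langle>\<langle>\<langle>e, w\<rangle>, j\<rangle>, t\<rangle>) V w 0 x) \<longrightarrow>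
        (\<forall>n. \<exists>h. eval (decode (code_length w)) (list_encode (list_decode j @ \<rho>)) = Some h \<and>
          \<langle>w, \<langle>0, n\<rangle>\<rangle> \<in> W h))"
proof -
  let ?w = "\<lambda>y. psnd (pfst (pfst y))" and ?a = "\<lambda>y. psnd (pfst y)" and ?j = "\<lambda>y. psnd y"
  let ?hyp = "\<lambda>w r n. \<exists>h. eval (decode (code_length w)) r = Some h \<and> \<langle>w, \<langle>0, n\<rangle>\<rangle> \<in> W h"
  \<comment> \<open>The negated locking condition, with an arbitrary index \<open>?a y\<close> in
    place of language \<open>0\<close>; this parameter breaks the circularity until the recursion
    theorem fills it in.\<close>
  define nE where "nE y \<longleftrightarrow> (\<exists>x. x \<in> set (list_decode (?j y)) \<and> \<not> x \<in> W (?a y)) \<or>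
    (\<exists>r. (code_length (?j y) \<le> code_length r \<and> (\<forall>k<code_length (?j y). code_nth r k = code_nth (?j y) k)) \<and>
      (\<forall>x\<in>set (list_decode r). x \<in> W (?a y)) \<and> (\<exists>n. \<not> ?hyp (?w y) r n))" for y
  have W2: "Sigma0 (Suc (Suc 0)) (\<lambda>z. x z \<in> W (e z))" "Sigma0 (Suc (Suc 0)) (\<lambda>z. \<not> x z \<in> W (e z))"
    if "computable e" "computable x" for x e
    by (rule Sigma0_Suc_if_Sigma0[OF ce_mem_W[OF that]])
      (rule Sigma0_Suc_if_Pi0, unfold not_not, rule ce_mem_W[OF that])
  have hyp2: "Sigma0 (Suc (Suc 0)) (\<lambda>z. \<not> ?hyp (w z) (r z) (n z))"
    if "computable w" "computable r" "computable n" for w r n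
    by (rule Sigma0_Suc_if_Pi0, unfold not_not, intro arith comp that that[THEN computable_comp])
  have "Sigma0 (Suc (Suc 0)) nE"
    unfolding nE_def by (intro hyp2 W2 arith comp)
  then have "Sigma0 (Suc (Suc 0)) (\<lambda>y. \<not> \<not> nE y)" by simp
  then obtain act where act: "decidable act" "\<And>y. \<not> nE y \<longleftrightarrow> infinite {t. act \<langle>y, t\<rangle>}"
    by (rule Pi2_infinite) blast
  \<comment> \<open>Language \<open>0\<close> contains all numbers and so is independent of
    \<open>V\<close>: it is enumerated from the actions alone.\<close>
  have "ce (\<lambda>v. pfst (psnd v) = psnd (pfst (pfst v)) \<and> (pfst (psnd (psnd v)) = 0 \<or>
      (\<exists>t. psnd (psnd (psnd v)) \<le> t \<and> (\<exists>j<pfst (psnd (psnd v)). act \<langle>\<langle>pfst v, j\<rangle>, t\<rangle>))))"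
    by (intro arith comp Sigma0_decidable[OF decidable_subst[OF act(1)]])
  then obtain a where a: "computable a" "\<And>z y. y \<in> W (a z) \<longleftrightarrow> pfst y = psnd z \<and> (pfst (psnd y) = 0 \<or>
      (\<exists>t. psnd (psnd y) \<le> t \<and> (\<exists>j<pfst (psnd y). act \<langle>\<langle>\<langle>z, a z\<rangle>, j\<rangle>, t\<rangle>)))"
    by (rule recursion_theorem) simp
  let ?act = "\<lambda>y. act \<langle>\<langle>\<langle>pfst (pfst y), a (pfst (pfst y))\<rangle>, psnd (pfst y)\<rangle>, psnd y\<rangle>"
  show thesis
  proof (rule that[of ?act])
    show "decidable ?act"
      by (intro decidable_subst[OF act(1)] comp computable_comp[OF a(1)])
    fix e w j V
    let ?z = "\<langle>e, w\<rangle>"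
    define A where "A x \<longleftrightarrow> member (\<lambda>j t. ?act \<langle>\<langle>?z, j\<rangle>, t\<rangle>) V w 0 x" for x
    define H where "H r \<longleftrightarrow> (\<forall>n. ?hyp w r n)" for r
    have mem: "x \<in> W (a ?z) \<longleftrightarrow> A x" for x
      unfolding a(2) A_def member_def acts_def by auto
    have "infinite {t. ?act \<langle>\<langle>?z, j\<rangle>, t\<rangle>} \<longleftrightarrow> \<not> nE \<langle>\<langle>?z, a ?z\<rangle>, j\<rangle>"
      by (simp add: act(2))
    also have "\<dots> \<longleftrightarrow> (\<forall>x\<in>set (list_decode j). A x) \<and>
      (\<forall>r. (\<exists>\<rho>. list_decode r = list_decode j @ \<rho>) \<longrightarrow> (\<forall>x\<in>set (list_decode r). A x) \<longrightarrow> H r)"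
      unfolding nE_def code_prefix_iff[symmetric] H_def prod_encode_inverse fst_conv snd_conv mem by blast
    also have "\<dots> \<longleftrightarrow> (\<forall>x\<in>set (list_decode j). A x) \<and>
      (\<forall>\<rho>. (\<forall>x\<in>set \<rho>. A x) \<longrightarrow> H (list_encode (list_decode j @ \<rho>)))"
    proof (intro conj_cong refl iffI allI impI)
      fix \<rho>
      assume *: "\<forall>r. (\<exists>\<rho>. list_decode r = list_decode j @ \<rho>) \<longrightarrow> (\<forall>x\<in>set (list_decode r). A x) \<longrightarrow> H r"
        and "\<forall>x\<in>set (list_decode j). A x" "\<forall>x\<in>set \<rho>. A x"
      then have "\<forall>x\<in>set (list_decode j @ \<rho>). A x" by auto
      then show "H (list_encode (list_decode j @ \<rho>))"
        using *[THEN spec, of "list_encode (list_decode j @ \<rho>)"] unfolding list_encode_inverse by blast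
    next
      fix r
      assume *: "\<forall>\<rho>. (\<forall>x\<in>set \<rho>. A x) \<longrightarrow> H (list_encode (list_decode j @ \<rho>))"
        and r: "\<exists>\<rho>. list_decode r = list_decode j @ \<rho>" "\<forall>x\<in>set (list_decode r). A x"
      then obtain \<rho> where \<rho>: "list_decode r = list_decode j @ \<rho>" by blast
      with r(2) have "\<forall>x\<in>set \<rho>. A x" by simp
      with * show "H r" by (metis \<rho> list_decode_inverse)
    qed
    finally have "infinite {t. ?act \<langle>\<langle>?z, j\<rangle>, t\<rangle>} \<longleftrightarrow> (\<forall>x\<in>set (list_decode j). A x) \<and>
      (\<forall>\<rho>. (\<forall>x\<in>set \<rho>. A x) \<longrightarrow> H (list_encode (list_decode j @ \<rho>)))" .
    then show "infinite {t. ?act \<langle>\<langle>?z, j\<rangle>, t\<rangle>} \<longleftrightarrow>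
      (\<forall>x\<in>set (list_decode j). member (\<lambda>j t. ?act \<langle>\<langle>?z, j\<rangle>, t\<rangle>) V w 0 x) \<and>
      (\<forall>\<rho>. (\<forall>x\<in>set \<rho>. member (\<lambda>j t. ?act \<langle>\<langle>?z, j\<rangle>, t\<rangle>) V w 0 x) \<longrightarrow>
        (\<forall>n. ?hyp w (list_encode (list_decode j @ \<rho>)) n))"
      unfolding A_def H_def .
  qed
qed

theorem theorem4p4:
  fixes P :: "nat \<Rightarrow> bool"
  assumes "Sigma0 5 P"
  shows "\<exists>h :: nat \<Rightarrow> nat. computable h \<and> (\<forall>e. P e \<longleftrightarrow> h e \<in> BCL)"
proof -
  have "Sigma0 (Suc (Suc (Suc (Suc (Suc 0))))) P" using assms by (simp add: eval_nat_numeral del: Sigma0.simps)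
  then obtain V where V: "ce V"
    "\<And>e. P e \<Longrightarrow> finite {w. infinite {n. \<not> V \<langle>\<langle>e, w\<rangle>, n\<rangle>}}"
    "\<And>e m. \<not> P e \<Longrightarrow> \<exists>w. code_length w = m \<and> infinite {n. \<not> V \<langle>\<langle>e, w\<rangle>, n\<rangle>}"
    by (rule Sigma5_normal_form) blast
  obtain act where act: "decidable act"
    "\<And>e w j V. infinite {t. act \<langle>\<langle>\<langle>e, w\<rangle>, j\<rangle>, t\<rangle>} \<longleftrightarrow>
      (\<forall>x\<in>set (list_decode j). member (\<lambda>j t. act \<langle>\<langle>\<langle>e, w\<rangle>, j\<rangle>, t\<rangle>) V w 0 x) \<and>
      (\<forall>\<rho>. (\<forall>x\<in>set \<rho>. member (\<lambda>j t. act \<langle>\<langle>\<langle>e, w\<rangle>, j\<rangle>, t\<rangle>) V w 0 x) \<longrightarrow>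
        (\<forall>n. \<exists>h. eval (decode (code_length w)) (list_encode (list_decode j @ \<rho>)) = Some h \<and>
          \<langle>w, \<langle>0, n\<rangle>\<rangle> \<in> W h))"
    by (rule ex_acting) blast
  let ?act = "\<lambda>e w j t. act \<langle>\<langle>\<langle>e, w\<rangle>, j\<rangle>, t\<rangle>" and ?V = "\<lambda>e w n. V \<langle>\<langle>e, w\<rangle>, n\<rangle>"
  note sub = Sigma0_decidable[OF decidable_subst[OF act(1)]] Sigma0_subst[OF V(1)]
  have ce_member: "ce (\<lambda>z. member (?act (e z) (w z)) (?V (e z) (w z)) (w z) (c z) (y z))"
    if "computable e" "computable w" "computable c" "computable y" for e w c y
    unfolding member_def acts_def by (intro arith comp sub that that[THEN computable_comp])

  have "ce (\<lambda>v. member (?act (pfst v) (pfst (pfst (psnd v)))) (?V (pfst v) (pfst (pfst (psnd v))))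
      (pfst (pfst (psnd v))) (psnd (pfst (psnd v))) (psnd (psnd v)))"
    by (intro ce_member comp)
  then obtain h where h: "computable h" "\<And>e c y. \<langle>c, y\<rangle> \<in> W (h e) \<longleftrightarrow>
      member (?act e (pfst c)) (?V e (pfst c)) (pfst c) (psnd c) y"
    by (rule smn) simp
  \<comment> \<open>Columns are indexed by pairs, which merges the families for all \<open>w\<close>
    into one.\<close>
  have column: "column (h e) \<langle>w, c\<rangle> = {y. member (?act e w) (?V e w) w c y}" for e w c
    unfolding column_def h(2) by simp

  have "ce (\<lambda>v. hypothesis (?act (pfst (pfst v)) (pfst (psnd (pfst v)))) (?V (pfst (pfst v)) (pfst (psnd (pfst v))))
      (pfst (psnd (pfst v))) (pfst (psnd (psnd (pfst v)))) (list_decode (psnd (psnd (psnd (pfst v))))) (psnd v))"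
    unfolding hypothesis_def acts_def
    by (intro arith comp sub ce_member)
  then obtain g where g: "computable g" "\<And>e w q r y. y \<in> W (g \<langle>e, \<langle>w, \<langle>q, r\<rangle>\<rangle>\<rangle>) \<longleftrightarrow>
      hypothesis (?act e w) (?V e w) w q (list_decode r) y"
    by (rule smn) simp

  have "P e \<longleftrightarrow> h e \<in> BCL" for e
  proof
    assume "P e"
    have "\<exists>q. \<forall>c f. content f = {y. member (?act e w) (?V e w) w c y} \<longrightarrow>
        (\<exists>n. \<forall>i>n. {y. hypothesis (?act e w) (?V e w) w q (initial_segment f i) y} =
          {y. member (?act e w) (?V e w) w c y})" for w
      using hypothesis_converges_coinfinite[of "?V e w" "?act e w" w]
        hypothesis_converges_cofinite[of "?V e w" _ "?act e w" w] by metis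
    then obtain q0 where q0: "\<And>w c f. content f = {y. member (?act e w) (?V e w) w c y} \<Longrightarrow>
        \<exists>n. \<forall>i>n. {y. hypothesis (?act e w) (?V e w) w (q0 w) (initial_segment f i) y} =
          {y. member (?act e w) (?V e w) w c y}"
      by metis
    \<comment> \<open>Dropping the advice where \<open>V\<close> is cofinite leaves it nonzero for
      finitely many \<open>w\<close> only, which makes \<open>q\<close> computable.\<close>
    define q where "q w = (if infinite {n. \<not> ?V e w n} then q0 w else 0)" for w
    have "finite {w. q w \<noteq> 0}"
      by (rule finite_subset[OF _ V(2)[OF \<open>P e\<close>]]) (auto simp: q_def)
    then have q_comp: "computable q" by (rule computable_finite_support)
    have q: "\<exists>n. \<forall>i>n. {y. hypothesis (?act e w) (?V e w) w (q w) (initial_segment f i) y} =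
        {y. member (?act e w) (?V e w) w c y}"
      if "content f = {y. member (?act e w) (?V e w) w c y}" for w c f
      using q0[OF that] hypothesis_converges_cofinite[OF _ that] unfolding q_def by simp
    \<comment> \<open>All elements of family \<open>w\<close> have first component \<open>w\<close>,
      so the first datum reveals the family. On the empty list \<open>code_nth\<close> gives 0, but
      convergence concerns only the nonempty segments \<open>i > n\<close>.\<close>
    let ?M = "\<lambda>r. g \<langle>e, \<langle>pfst (code_nth r 0), \<langle>q (pfst (code_nth r 0)), r\<rangle>\<rangle>\<rangle>"
    have "computable ?M" by (intro comp computable_comp[OF g(1)] computable_comp[OF q_comp])
    then have "learning_machine (\<lambda>\<tau>. Some (?M (list_encode \<tau>)))"
      unfolding learning_machine_def computable_def by metis
    moreover have "TxtBC_identifies (\<lambda>\<tau>. Some (?M (list_encode \<tau>))) f"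
      if f: "content f = column (h e) v" for v f
    proof -
      obtain w c where v: "v = \<langle>w, c\<rangle>" by (rule pair_cases)
      have f: "content f = {y. member (?act e w) (?V e w) w c y}" using that unfolding v column .
      then obtain n where n: "\<And>i. i > n \<Longrightarrow>
          {y. hypothesis (?act e w) (?V e w) w (q w) (initial_segment f i) y} = content f"
        using q by metis
      have "f 0 \<in> content f" unfolding content_def by blast
      then have f0: "pfst (f 0) = w" unfolding f by (simp add: member_def)
      have "W (?M (list_encode (initial_segment f i))) = content f" if "i > n" for i
      proof -
        let ?r = "list_encode (initial_segment f i)"
        have "code_nth ?r 0 = f 0"
          using \<open>i > n\<close> by (simp add: code_nth code_length_def) (simp add: initial_segment_def)
        then have w: "pfst (code_nth ?r 0) = w" using f0 by simp
        have "W (?M ?r) = {y. hypothesis (?act e w) (?V e w) w (q w) (initial_segment f i) y}"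
          unfolding w by (rule set_eqI) (simp only: g(2) list_encode_inverse mem_Collect_eq)
        then show ?thesis using n[OF that] by simp
      qed
      then show ?thesis unfolding TxtBC_identifies_def by blast
    qed
    ultimately show "h e \<in> BCL"
      unfolding BCL_def TxtBC_learnable_def TxtBC_learns_family_def TxtBC_learns_set_def
        uce_family_def enumeration_of_def by blast
  next
    assume "h e \<in> BCL"
    show "P e"
    proof (rule ccontr)
      assume "\<not> P e"
      from \<open>h e \<in> BCL\<close> obtain M C where M: "\<And>\<tau>. M \<tau> = eval C (list_encode \<tau>)"
        and learns: "\<And>v. TxtBC_learns_set M (column (h e) v)"
        unfolding BCL_def TxtBC_learnable_def TxtBC_learns_family_def uce_family_def learning_machine_def
        by blast
      \<comment> \<open>The length of \<open>w\<close> is chosen as the code of the given learner,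
        so that family \<open>w\<close> is the one aimed at it.\<close>
      obtain w where w: "code_length w = encode C" "infinite {n. \<not> ?V e w n}"
        using V(3)[OF \<open>\<not> P e\<close>] by blast
      have "M \<tau> = eval (decode (code_length w)) (list_encode \<tau>)" for \<tau>
        unfolding M w(1) decode_encode ..
      then have "\<exists>c. \<not> TxtBC_learns_set M {y. member (?act e w) (?V e w) w c y}"
        by (intro defeats_machine[OF _ w(2)]) (simp only: act(2)[of e w _ "?V e w"])
      then show False using learns unfolding column[symmetric] by blast
    qed
  qed
  then show ?thesis using h(1) by blast
qed

end
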